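(* Let $\mathfrak g$ be a finite-dimensional real Lie algebra, $\mathcal E=\mathcal E(\mathfrak g)$ its complex universal enveloping algebra, $\mathcal H$ a complex Hilbert space, $\mathcal F\subseteq\mathcal H$ a dense subspace, and $\pi:\mathcal E\to\mathcal L^\dagger(\mathcal F)$ an unbounded representation with a cyclic vector $\nu\in\mathcal F$ (i.e. $\mathcal F=\pi(\mathcal E)\nu$). Suppose $J:\mathcal H\to\mathcal H$ is an anti-unitary operator commuting with the action of $\mathfrak g$ and such that $J\nu=\nu$. For $\xi\in\mathcal F$ define $e_\xi\in\mathcal E^\dagger$ by $e_\xi(E)=\langle J\xi,E\nu\rangle$, where $E\nu=\pi(E)\nu$, and let $\mathcal A$ be the involutive subalgebra of $\mathcal E^\dagger$ generated by $\{e_\xi\mid\xi\in\mathcal F\}$. Then $$E\,e_\xi=e_{E\xi}\qquad\text{for all }\xi\in\mathcal F,\ E\in\mathcal E.$$ In particular, $\mathcal A$ is an $\mathcal E$-submodule of $\mathcal E^\dagger$.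
   Context: Scalar products are anti-linear in the first argument. $\mathcal E(\mathfrak g)$ is the quotient of the complex tensor algebra $\bigl(\bigoplus_{n\ge 0}\mathfrak g^{\otimes n}\bigr)\otimes\mathbb C$ by the two-sided ideal generated by $XY-YX-[X,Y]$, $X,Y\in\mathfrak g$. It carries: the involution $\dagger$, the anti-linear extension of $(X_1\cdots X_n)^\dagger=(-1)^nX_n\cdots X_1$ ($X_i\in\mathfrak g$); the complex conjugation, the anti-linear extension of $\overline{X_1\cdots X_n}=X_1\cdots X_n$; and the coproduct $\Delta$, the unique algebra morphism $\mathcal E\to\mathcal E\otimes\mathcal E$ with $\Delta(X)=1\otimes X+X\otimes 1$ for $X\in\mathfrak g$. $\mathcal E_{\mathbb R}$ is the set of elements fixed by the conjugation. $\mathcal L^\dagger(\mathcal F)$ is the algebra of linear operators $A:\mathcal F\to\mathcal F$ with $\mathcal F\subseteq\operatorname{dom}(A^* )$ and $A^*\mathcal F\subseteq\mathcal F$, with involution $A^\dagger=A^*|_{\mathcal F}$. An unbounded representation is a (unital) algebra morphism $\pi:\mathcal E\to\mathcal L^\dagger(\mathcal F)$ with $\pi(E^\dagger)=\pi(E)^\dagger$; one writes $E\xi$ for $\pi(E)\xi$. That $J$ commutes with the action of $\mathfrak g$ means $J\mathcal F\subseteq\mathcal F$ and $J\pi(X)\xi=\pi(X)J\xi$ for $X\in\mathfrak g$, $\xi\in\mathcal F$ (hence $J\pi(E)=\pi(\overline E)J$ on $\mathcal F$ for $E\in\mathcal E$). $\mathcal E^\dagger$ is the space of all $\mathbb C$-linear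 maps $\mathcal E\to\mathbb C$, a commutative algebra with product $ab=(a\otimes b)\circ\Delta$, with involution $a^\dagger(E+\mathrm iF)=\overline{a(E)}+\mathrm i\,\overline{a(F)}$ for $E,F\in\mathcal E_{\mathbb R}$, and with $\mathcal E$-module structure $(Ea)(F)=a\bigl(\overline{E}^{\,\dagger}F\bigr)$. The involutive subalgebra generated by a set is the smallest unital subalgebra containing it and closed under $a\mapsto a^\dagger$. *)

theory Defs
  imports "HOL-Analysis.Analysis" "HOL-Library.Poly_Mapping" "HOL-Library.FuncSet"
begin

section \<open>Complex vector spaces, algebras and Hilbert spaces\<close>

class complex_vector = ab_group_add +
  fixes scaleC :: "complex \<Rightarrow> 'a \<Rightarrow> 'a"  (infixr \<open>*\<^sub>C\<close> 75)
  assumes scaleC_add_right: "c *\<^sub>C (x + y) = c *\<^sub>C x + c *\<^sub>C y"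
    and scaleC_add_left: "(c + d) *\<^sub>C x = c *\<^sub>C x + d *\<^sub>C x"
    and scaleC_scaleC: "c *\<^sub>C (d *\<^sub>C x) = (c * d) *\<^sub>C x"
    and scaleC_one: "1 *\<^sub>C x = x"

global_interpretation complex_vector: vector_space "scaleC :: complex \<Rightarrow> 'a \<Rightarrow> 'a::complex_vector"
  defines csubspace = complex_vector.subspace
    and cspan = complex_vector.span
  by unfold_locales (simp_all add: scaleC_add_right scaleC_add_left scaleC_scaleC scaleC_one)

abbreviation clinear :: "('a::complex_vector \<Rightarrow> 'b::complex_vector) \<Rightarrow> bool"
  where "clinear \<equiv> Vector_Spaces.linear scaleC scaleC"

lemma clinear_iff:
  "clinear f \<longleftrightarrow> (\<forall>x y. f (x + y) = f x + f y) \<and> (\<forall>c x. f (c *\<^sub>C x) = c *\<^sub>C f x)"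
  by (simp add: Vector_Spaces.linear_iff complex_vector.vector_space_axioms)

lemma clinear_add: "clinear f \<Longrightarrow> f (x + y) = f x + f y"
  and clinear_scale: "clinear f \<Longrightarrow> f (c *\<^sub>C x) = c *\<^sub>C f x"
  by (simp_all add: clinear_iff)

lemma clinear_diff:
  assumes "clinear f" shows "f (x - y) = f x - f y"
  using clinear_add[OF assms, of "x - y" y] by simp

lemma clinear_0: "clinear f \<Longrightarrow> f 0 = 0"
  using clinear_diff[of f 0 0] by simp

lemma clinear_sum: "clinear f \<Longrightarrow> f (sum g A) = (\<Sum>a\<in>A. f (g a))"
  by (induction A rule: infinite_finite_induct) (simp_all add: clinear_0 clinear_add)

lemma csubspace_iff:
  "csubspace S \<longleftrightarrow> 0 \<in> S \<and> (\<forall>x\<in>S. \<forall>y\<in>S. x + y \<in> S) \<and> (\<forall>c. \<forall>x\<in>S. c *\<^sub>C x \<in> S)"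
  by (simp add: complex_vector.subspace_def)

text \<open>Associative unital complex algebras; the zero algebra is allowed.\<close>

class complex_algebra_1 = complex_vector + ring + monoid_mult +
  assumes scaleC_mult_left: "(c *\<^sub>C x) * y = c *\<^sub>C (x * y)"
    and scaleC_mult_right: "x * (c *\<^sub>C y) = c *\<^sub>C (x * y)"

instantiation complex :: complex_algebra_1
begin
definition scaleC_complex :: "complex \<Rightarrow> complex \<Rightarrow> complex" where [simp]: "c *\<^sub>C x = c * x"
instance by standard (simp_all add: algebra_simps)
end

text \<open>
  The class \<^class>\<open>banach\<close> supplies the norm and completeness; the axioms below tie the complex
  structure and the scalar product, anti-linear in its first argument, to it.
\<close>

class complex_hilbert_space = banach + complex_vector +
  fixes cinner :: "'a \<Rightarrow> 'a \<Rightarrow> complex"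
  assumes scaleR_scaleC: "r *\<^sub>R x = complex_of_real r *\<^sub>C x"
    and cinner_commute: "cinner x y = cnj (cinner y x)"
    and cinner_add_right: "cinner x (y + z) = cinner x y + cinner x z"
    and cinner_scaleC_right: "cinner x (c *\<^sub>C y) = c * cinner x y"
    and cinner_self: "cinner x x = complex_of_real ((norm x)\<^sup>2)"

definition two_sided_ideal :: "'a::complex_algebra_1 set \<Rightarrow> bool" where
  "two_sided_ideal I \<longleftrightarrow> csubspace I \<and> (\<forall>x\<in>I. \<forall>a. a * x \<in> I \<and> x * a \<in> I)"

definition unital_algebra_hom :: "('a::complex_algebra_1 \<Rightarrow> 'b::complex_algebra_1) \<Rightarrow> bool" where
  "unital_algebra_hom \<phi> \<longleftrightarrow> clinear \<phi> \<and> \<phi> 1 = 1 \<and> (\<forall>x y. \<phi> (x * y) = \<phi> x * \<phi> y)"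

lemma two_sided_ideal_hull: "two_sided_ideal (two_sided_ideal hull S)"
  unfolding hull_def two_sided_ideal_def csubspace_iff by blast

lemma two_sided_ideal_hull_induct [consumes 1, case_names base zero add scale mult_left mult_right]:
  assumes "x \<in> two_sided_ideal hull S"
    and "\<And>x. x \<in> S \<Longrightarrow> P x" and "P 0" and "\<And>x y. P x \<Longrightarrow> P y \<Longrightarrow> P (x + y)"
    and "\<And>c x. P x \<Longrightarrow> P (c *\<^sub>C x)"
    and "\<And>a x. P x \<Longrightarrow> P (a * x)" and "\<And>a x. P x \<Longrightarrow> P (x * a)"
  shows "P x"
proof -
  have "two_sided_ideal {x. P x}" "S \<subseteq> {x. P x}"
    using assms(2-) by (auto simp: two_sided_ideal_def csubspace_iff)
  then show ?thesis
    using hull_minimal[of S "{x. P x}" two_sided_ideal] assms(1) by blast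
qed

lemma equivp_csubspace: "csubspace S \<Longrightarrow> equivp (\<lambda>p q. p - q \<in> S)"
proof (rule equivpI)
  assume S: "csubspace S"
  show "reflp (\<lambda>p q. p - q \<in> S)"
    using S by (simp add: reflp_def complex_vector.subspace_0)
  show "symp (\<lambda>p q. p - q \<in> S)"
    unfolding symp_def using complex_vector.subspace_neg[OF S] by (metis minus_diff_eq)
  show "transp (\<lambda>p q. p - q \<in> S)"
    unfolding transp_def using complex_vector.subspace_add[OF S] by (metis diff_add_cancel add_diff_eq)
qed

lemma csubspace_resp:
  assumes "csubspace S"
  shows "a - a' \<in> S \<Longrightarrow> b - b' \<in> S \<Longrightarrow> (a + b) - (a' + b') \<in> S"
    and "a - a' \<in> S \<Longrightarrow> b - b' \<in> S \<Longrightarrow> (a - b) - (a' - b') \<in> S"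
    and "a - a' \<in> S \<Longrightarrow> (- a) - (- a') \<in> S"
    and "a - a' \<in> S \<Longrightarrow> (c *\<^sub>C a) - (c *\<^sub>C a') \<in> S"
proof -
  show "a - a' \<in> S \<Longrightarrow> b - b' \<in> S \<Longrightarrow> (a + b) - (a' + b') \<in> S"
    using complex_vector.subspace_add[OF assms, of "a - a'" "b - b'"] by (simp add: algebra_simps)
  show "a - a' \<in> S \<Longrightarrow> b - b' \<in> S \<Longrightarrow> (a - b) - (a' - b') \<in> S"
    using complex_vector.subspace_diff[OF assms, of "a - a'" "b - b'"] by (simp add: algebra_simps)
  show "a - a' \<in> S \<Longrightarrow> (- a) - (- a') \<in> S"
    using complex_vector.subspace_neg[OF assms, of "a - a'"] by (simp add: algebra_simps)
  show "a - a' \<in> S \<Longrightarrow> (c *\<^sub>C a) - (c *\<^sub>C a') \<in> S"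
    using complex_vector.subspace_scale[OF assms, of "a - a'" c]
    by (simp add: complex_vector.scale_right_diff_distrib)
qed

lemma two_sided_ideal_resp:
  assumes "two_sided_ideal I" "a - a' \<in> I" "b - b' \<in> I"
  shows "a * b - a' * b' \<in> I"
proof -
  have "(a - a') * b + a' * (b - b') \<in> I"
    using assms unfolding two_sided_ideal_def by (meson complex_vector.subspace_add)
  then show ?thesis by (simp add: algebra_simps)
qed


section \<open>Free complex vector spaces\<close>

instantiation poly_mapping :: (type, complex_vector) complex_vector
begin
lift_definition scaleC_poly_mapping :: "complex \<Rightarrow> ('a \<Rightarrow>\<^sub>0 'b) \<Rightarrow> 'a \<Rightarrow>\<^sub>0 'b"
  is "\<lambda>c p k. c *\<^sub>C p k"
  by (erule rev_finite_subset) auto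
instance
  by standard (transfer; simp add: scaleC_add_right scaleC_add_left scaleC_scaleC scaleC_one)+
end

lemma lookup_scaleC [simp]: "Poly_Mapping.lookup (c *\<^sub>C p) k = c *\<^sub>C Poly_Mapping.lookup p k"
  by transfer simp

lemma scaleC_single: "c *\<^sub>C Poly_Mapping.single k d = Poly_Mapping.single k (c *\<^sub>C d)"
  by (rule poly_mapping_eqI) (simp add: lookup_single when_def)

abbreviation free_basis :: "'k \<Rightarrow> ('k \<Rightarrow>\<^sub>0 complex)" where
  "free_basis k \<equiv> Poly_Mapping.single k 1"

definition free_extend :: "('k \<Rightarrow> 'v::complex_vector) \<Rightarrow> ('k \<Rightarrow>\<^sub>0 complex) \<Rightarrow> 'v" where
  "free_extend f p = (\<Sum>k\<in>Poly_Mapping.keys p. Poly_Mapping.lookup p k *\<^sub>C f k)"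

lemma free_extend_superset:
  assumes "finite A" "Poly_Mapping.keys p \<subseteq> A"
  shows "free_extend f p = (\<Sum>k\<in>A. Poly_Mapping.lookup p k *\<^sub>C f k)"
  unfolding free_extend_def using assms
  by (intro sum.mono_neutral_left) (auto simp: in_keys_iff)

lemma clinear_free_extend: "clinear (free_extend f)"
  unfolding clinear_iff
proof safe
  fix p q :: "'a \<Rightarrow>\<^sub>0 complex" and c :: complex
  let ?A = "Poly_Mapping.keys p \<union> Poly_Mapping.keys q"
  have "free_extend f (p + q) = (\<Sum>k\<in>?A. Poly_Mapping.lookup (p + q) k *\<^sub>C f k)"
    by (rule free_extend_superset) (simp_all add: keys_add)
  also have "\<dots> = (\<Sum>k\<in>?A. Poly_Mapping.lookup p k *\<^sub>C f k) + (\<Sum>k\<in>?A. Poly_Mapping.lookup q k *\<^sub>C f k)"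
    by (simp add: lookup_add scaleC_add_left sum.distrib)
  also have "\<dots> = free_extend f p + free_extend f q"
    by (simp add: free_extend_superset[of ?A, symmetric])
  finally show "free_extend f (p + q) = free_extend f p + free_extend f q" .
  have "Poly_Mapping.keys (c *\<^sub>C p) \<subseteq> Poly_Mapping.keys p"
    by (auto simp: in_keys_iff)
  then have "free_extend f (c *\<^sub>C p) = (\<Sum>k\<in>Poly_Mapping.keys p. Poly_Mapping.lookup (c *\<^sub>C p) k *\<^sub>C f k)"
    by (intro free_extend_superset) simp_all
  then show "free_extend f (c *\<^sub>C p) = c *\<^sub>C free_extend f p"
    by (simp add: free_extend_def complex_vector.scale_sum_right scaleC_scaleC)
qed

lemma free_extend_single [simp]: "free_extend f (Poly_Mapping.single k c) = c *\<^sub>C f k"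
  by (cases "c = 0") (simp_all add: free_extend_def)

lemma free_expansion: "p = (\<Sum>k\<in>Poly_Mapping.keys p. Poly_Mapping.lookup p k *\<^sub>C free_basis k)"
  by (rule poly_mapping_eqI)
    (auto simp: lookup_sum lookup_single when_def in_keys_iff if_distrib[of "(*) _"] cong: if_cong)

lemma free_induct:
  assumes "P 0" "\<And>p q. P p \<Longrightarrow> P q \<Longrightarrow> P (p + q)" "\<And>k c. P (Poly_Mapping.single k (c::complex))"
  shows "P p"
proof -
  have "P (\<Sum>k\<in>A. Poly_Mapping.lookup p k *\<^sub>C free_basis k)" for A
    by (induction A rule: infinite_finite_induct) (simp_all add: assms scaleC_single)
  then show ?thesis using free_expansion[of p] by metis
qed

instance poly_mapping :: (monoid_add, "{complex_algebra_1, ring_1}") complex_algebra_1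
proof
  fix c and x y :: "'a \<Rightarrow>\<^sub>0 'b"
  have s: "c *\<^sub>C z = Poly_Mapping.single 0 (c *\<^sub>C 1) * z" for c and z :: "'a \<Rightarrow>\<^sub>0 'b"
  proof -
    have *: "Poly_Mapping.map ((*) (c *\<^sub>C 1)) z = c *\<^sub>C z"
      by (rule poly_mapping_eqI) (auto simp: Poly_Mapping.map.rep_eq when_def scaleC_mult_left)
    show ?thesis by (simp add: mult_map_scale_conv_mult[symmetric] *)
  qed
  show "(c *\<^sub>C x) * y = c *\<^sub>C (x * y)" by (simp add: s[of c] mult.assoc)
  have "x * Poly_Mapping.single 0 (c *\<^sub>C 1) = Poly_Mapping.single 0 (c *\<^sub>C 1) * x"
  proof -
    have "x * Poly_Mapping.single 0 d = Poly_Mapping.map (\<lambda>e. e * d) x" for d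
    proof (rule poly_mapping_eqI)
      fix k
      have when_eq: "((d when 0 = b) when k = a + b) = ((d when k = a) when b = 0)" for a b :: 'a
        by (auto simp: when_def)
      have "Poly_Mapping.lookup (x * Poly_Mapping.single 0 d) k
        = prod_fun (Poly_Mapping.lookup x) (Poly_Mapping.lookup (Poly_Mapping.single 0 d)) k"
        by (simp add: times_poly_mapping.rep_eq)
      also have "\<dots> = (\<Sum>a. Poly_Mapping.lookup x a * (\<Sum>b::'a. (d when k = a) when b = 0))"
        by (simp only: prod_fun_def lookup_single when_eq)
      also have "\<dots> = Poly_Mapping.lookup x k * d"
        by (simp add: mult_when)
      finally show "Poly_Mapping.lookup (x * Poly_Mapping.single 0 d) k
        = Poly_Mapping.lookup (Poly_Mapping.map (\<lambda>e. e * d) x) k"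
        by (simp add: Poly_Mapping.map.rep_eq when_def)
    qed
    moreover have "Poly_Mapping.map (\<lambda>e. e * (c *\<^sub>C 1)) x = Poly_Mapping.map ((*) (c *\<^sub>C 1)) x"
      by (rule poly_mapping_eqI)
        (simp add: Poly_Mapping.map.rep_eq when_def scaleC_mult_left scaleC_mult_right)
    ultimately show ?thesis by (simp add: mult_map_scale_conv_mult)
  qed
  then show "x * (c *\<^sub>C y) = c *\<^sub>C (x * y)" by (simp add: s[of c] mult.assoc[symmetric])
qed

lemma free_extend_mult:
  fixes f :: "'k::monoid_add \<Rightarrow> 'a::complex_algebra_1"
  assumes "\<And>k l. f (k + l) = f k * f l"
  shows "free_extend f (p * q) = free_extend f p * free_extend f q"
proof (induction p rule: free_induct)
  case (3 k c)
  show ?case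
    by (induction q rule: free_induct)
      (simp_all add: clinear_0[OF clinear_free_extend] clinear_add[OF clinear_free_extend] mult_single
        assms distrib_left scaleC_mult_left scaleC_mult_right scaleC_scaleC)
qed (simp_all add: clinear_0[OF clinear_free_extend] clinear_add[OF clinear_free_extend] distrib_right)

lemma cspan_ideal:
  fixes R :: "('k::monoid_add \<Rightarrow>\<^sub>0 complex) set"
  assumes "\<And>r k. r \<in> R \<Longrightarrow> free_basis k * r \<in> R" "\<And>r k. r \<in> R \<Longrightarrow> r * free_basis k \<in> R"
  shows "two_sided_ideal (cspan R)"
  unfolding two_sided_ideal_def
proof safe
  fix x a assume x: "x \<in> cspan R"
  have l: "free_basis k * x \<in> cspan R" for k using x
    by (induction rule: complex_vector.span_induct_alt)
      (simp_all add: complex_vector.span_zero distrib_left scaleC_mult_right complex_vector.span_add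
        complex_vector.span_scale complex_vector.span_base assms)
  have r: "x * free_basis k \<in> cspan R" for k using x
    by (induction rule: complex_vector.span_induct_alt)
      (simp_all add: complex_vector.span_zero distrib_right scaleC_mult_left complex_vector.span_add
        complex_vector.span_scale complex_vector.span_base assms)
  show "a * x \<in> cspan R"
  proof (induction a rule: free_induct)
    case (3 k c)
    have "Poly_Mapping.single k c * x = c *\<^sub>C (free_basis k * x)"
      by (simp add: scaleC_mult_left[symmetric] scaleC_single)
    then show ?case using complex_vector.span_scale[OF l] by simp
  qed (simp_all add: complex_vector.span_zero complex_vector.span_add distrib_right)
  show "x * a \<in> cspan R"
  proof (induction a rule: free_induct)
    case (3 k c)
    have "x * Poly_Mapping.single k c = c *\<^sub>C (x * free_basis k)"
      by (simp add: scaleC_mult_right[symmetric] scaleC_single)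
    then show ?case using complex_vector.span_scale[OF r] by simp
  qed (simp_all add: complex_vector.span_zero complex_vector.span_add distrib_left)
qed


section \<open>Tensor algebra and universal enveloping algebra\<close>

class lie_algebra = real_vector +
  fixes lie_bracket :: "'a \<Rightarrow> 'a \<Rightarrow> 'a"  (\<open>\<lbrakk>_, _\<rbrakk>\<^sub>L\<close>)
  assumes lie_bracket_add_left: "\<lbrakk>x + y, z\<rbrakk>\<^sub>L = \<lbrakk>x, z\<rbrakk>\<^sub>L + \<lbrakk>y, z\<rbrakk>\<^sub>L"
    and lie_bracket_add_right: "\<lbrakk>x, y + z\<rbrakk>\<^sub>L = \<lbrakk>x, y\<rbrakk>\<^sub>L + \<lbrakk>x, z\<rbrakk>\<^sub>L"
    and lie_bracket_scaleR_left: "\<lbrakk>r *\<^sub>R x, y\<rbrakk>\<^sub>L = r *\<^sub>R \<lbrakk>x, y\<rbrakk>\<^sub>L"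
    and lie_bracket_scaleR_right: "\<lbrakk>x, r *\<^sub>R y\<rbrakk>\<^sub>L = r *\<^sub>R \<lbrakk>x, y\<rbrakk>\<^sub>L"
    and lie_bracket_self: "\<lbrakk>x, x\<rbrakk>\<^sub>L = 0"
    and jacobi: "\<lbrakk>x, \<lbrakk>y, z\<rbrakk>\<^sub>L\<rbrakk>\<^sub>L + \<lbrakk>y, \<lbrakk>z, x\<rbrakk>\<^sub>L\<rbrakk>\<^sub>L + \<lbrakk>z, \<lbrakk>x, y\<rbrakk>\<^sub>L\<rbrakk>\<^sub>L = 0"

text \<open>
  Words over the Lie algebra, with concatenation written additively, so that the convolution
  product of \<^theory>\<open>HOL-Library.Poly_Mapping\<close> is concatenation of words.
\<close>

datatype 'g fword = Word (letters: "'g list")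

instantiation fword :: (type) monoid_add
begin
definition zero_fword :: "'a fword" where "0 = Word []"
definition plus_fword :: "'a fword \<Rightarrow> 'a fword \<Rightarrow> 'a fword" where
  "v + w = Word (letters v @ letters w)"
instance by standard (simp_all add: zero_fword_def plus_fword_def)
end

text \<open>
  The quotient of the complex vector space on all words by the multilinearity relations is
  \<open>(\<Oplus>\<^sub>n \<gg>\<^sup>\<otimes>\<^sup>n) \<otimes> \<complex>\<close>; words of length \<open>n\<close> give the \<open>n\<close>-th summand.
\<close>

definition multilinear_relations :: "('g::real_vector fword \<Rightarrow>\<^sub>0 complex) set" where
  "multilinear_relations =
    {free_basis (Word (us @ [x + y] @ vs)) - free_basis (Word (us @ [x] @ vs))
        - free_basis (Word (us @ [y] @ vs)) | us vs x y. True} \<union>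
    {free_basis (Word (us @ [r *\<^sub>R x] @ vs))
        - complex_of_real r *\<^sub>C free_basis (Word (us @ [x] @ vs)) | us vs r x. True}"

lemma mult_free_basis [simp]: "free_basis k * free_basis l = free_basis (k + l)"
  by (simp add: mult_single)

lemma multilinear_relations_mult:
  assumes "p \<in> multilinear_relations"
  shows "free_basis w * p \<in> multilinear_relations" "p * free_basis w \<in> multilinear_relations"
proof -
  obtain ws where w: "w = Word ws" by (cases w)
  consider us vs x y where "p = free_basis (Word (us @ [x + y] @ vs)) - free_basis (Word (us @ [x] @ vs))
        - free_basis (Word (us @ [y] @ vs))"
    | us vs r x where "p = free_basis (Word (us @ [r *\<^sub>R x] @ vs))
        - complex_of_real r *\<^sub>C free_basis (Word (us @ [x] @ vs))"
    using assms unfolding multilinear_relations_def by blast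
  then have "free_basis w * p \<in> multilinear_relations \<and> p * free_basis w \<in> multilinear_relations"
  proof cases
    case 1
    have "free_basis w * p = free_basis (Word ((ws @ us) @ [x + y] @ vs))
        - free_basis (Word ((ws @ us) @ [x] @ vs)) - free_basis (Word ((ws @ us) @ [y] @ vs))"
      "p * free_basis w = free_basis (Word (us @ [x + y] @ (vs @ ws)))
        - free_basis (Word (us @ [x] @ (vs @ ws))) - free_basis (Word (us @ [y] @ (vs @ ws)))"
      by (simp_all add: 1 w right_diff_distrib left_diff_distrib plus_fword_def)
    then show ?thesis unfolding multilinear_relations_def by blast
  next
    case 2
    have "free_basis w * p = free_basis (Word ((ws @ us) @ [r *\<^sub>R x] @ vs))
        - complex_of_real r *\<^sub>C free_basis (Word ((ws @ us) @ [x] @ vs))"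
      "p * free_basis w = free_basis (Word (us @ [r *\<^sub>R x] @ (vs @ ws)))
        - complex_of_real r *\<^sub>C free_basis (Word (us @ [x] @ (vs @ ws)))"
      by (simp_all add: 2 w right_diff_distrib left_diff_distrib plus_fword_def
          scaleC_mult_right scaleC_mult_left del: scaleC_complex_def)
    then show ?thesis unfolding multilinear_relations_def by blast
  qed
  then show "free_basis w * p \<in> multilinear_relations" "p * free_basis w \<in> multilinear_relations"
    by blast+
qed

lemma multilinear_ideal: "two_sided_ideal (cspan multilinear_relations)"
  by (intro cspan_ideal multilinear_relations_mult)

lemma csubspace_ideal: "two_sided_ideal I \<Longrightarrow> csubspace I"
  by (simp add: two_sided_ideal_def)

lemma csubspace_self: "csubspace S \<Longrightarrow> x = y \<Longrightarrow> x - y \<in> S"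
  by (simp add: complex_vector.subspace_0)

quotient_type (overloaded) 'g tensor_algebra = "'g::real_vector fword \<Rightarrow>\<^sub>0 complex"
  / "\<lambda>p q. p - q \<in> cspan multilinear_relations"
  by (rule equivp_csubspace[OF csubspace_ideal[OF multilinear_ideal]])

instantiation tensor_algebra :: (real_vector) complex_algebra_1
begin
lift_definition zero_tensor_algebra :: "'a tensor_algebra" is 0 .
lift_definition one_tensor_algebra :: "'a tensor_algebra" is 1 .
lift_definition plus_tensor_algebra :: "'a tensor_algebra \<Rightarrow> 'a tensor_algebra \<Rightarrow> 'a tensor_algebra" is "(+)"
  by (rule csubspace_resp[OF csubspace_ideal[OF multilinear_ideal]])
lift_definition minus_tensor_algebra :: "'a tensor_algebra \<Rightarrow> 'a tensor_algebra \<Rightarrow> 'a tensor_algebra" is "(-)"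
  by (rule csubspace_resp[OF csubspace_ideal[OF multilinear_ideal]])
lift_definition uminus_tensor_algebra :: "'a tensor_algebra \<Rightarrow> 'a tensor_algebra" is uminus
  by (rule csubspace_resp[OF csubspace_ideal[OF multilinear_ideal]])
lift_definition scaleC_tensor_algebra :: "complex \<Rightarrow> 'a tensor_algebra \<Rightarrow> 'a tensor_algebra" is scaleC
  by (rule csubspace_resp[OF csubspace_ideal[OF multilinear_ideal]])
lift_definition times_tensor_algebra :: "'a tensor_algebra \<Rightarrow> 'a tensor_algebra \<Rightarrow> 'a tensor_algebra" is "(*)"
  by (rule two_sided_ideal_resp[OF multilinear_ideal])
instance
  by standard (transfer; rule csubspace_self[OF csubspace_ideal[OF multilinear_ideal]];
      simp add: algebra_simps scaleC_add_right scaleC_add_left scaleC_scaleC scaleC_one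
        scaleC_mult_left scaleC_mult_right)+
end

lift_definition tensor_gen :: "'g::real_vector \<Rightarrow> 'g tensor_algebra" is "\<lambda>x. free_basis (Word [x])" .

definition uea_ideal :: "'g::lie_algebra tensor_algebra set" where
  "uea_ideal = two_sided_ideal hull
    {tensor_gen x * tensor_gen y - tensor_gen y * tensor_gen x - tensor_gen \<lbrakk>x, y\<rbrakk>\<^sub>L | x y. True}"

lemma uea_ideal: "two_sided_ideal uea_ideal"
  unfolding uea_ideal_def by (rule two_sided_ideal_hull)

quotient_type (overloaded) 'g uea = "'g::lie_algebra tensor_algebra" / "\<lambda>p q. p - q \<in> uea_ideal"
  by (rule equivp_csubspace[OF csubspace_ideal[OF uea_ideal]])

instantiation uea :: (lie_algebra) complex_algebra_1
begin
lift_definition zero_uea :: "'a uea" is 0 .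
lift_definition one_uea :: "'a uea" is 1 .
lift_definition plus_uea :: "'a uea \<Rightarrow> 'a uea \<Rightarrow> 'a uea" is "(+)"
  by (rule csubspace_resp[OF csubspace_ideal[OF uea_ideal]])
lift_definition minus_uea :: "'a uea \<Rightarrow> 'a uea \<Rightarrow> 'a uea" is "(-)"
  by (rule csubspace_resp[OF csubspace_ideal[OF uea_ideal]])
lift_definition uminus_uea :: "'a uea \<Rightarrow> 'a uea" is uminus
  by (rule csubspace_resp[OF csubspace_ideal[OF uea_ideal]])
lift_definition scaleC_uea :: "complex \<Rightarrow> 'a uea \<Rightarrow> 'a uea" is scaleC
  by (rule csubspace_resp[OF csubspace_ideal[OF uea_ideal]])
lift_definition times_uea :: "'a uea \<Rightarrow> 'a uea \<Rightarrow> 'a uea" is "(*)"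
  by (rule two_sided_ideal_resp[OF uea_ideal])
instance
  by standard (transfer; rule csubspace_self[OF csubspace_ideal[OF uea_ideal]];
      simp add: algebra_simps scaleC_add_right scaleC_add_left scaleC_scaleC scaleC_one
        scaleC_mult_left scaleC_mult_right)+
end

lift_definition uea_gen :: "'g::lie_algebra \<Rightarrow> 'g uea" is tensor_gen .

lemma uea_gen_add: "uea_gen (x + y) = uea_gen x + uea_gen y"
proof -
  have "tensor_gen (x + y) = tensor_gen x + tensor_gen y"
  proof transfer
    fix x y :: 'a
    have "free_basis (Word ([] @ [x + y] @ [])) - free_basis (Word ([] @ [x] @ []))
        - free_basis (Word ([] @ [y] @ [])) \<in> multilinear_relations"
      unfolding multilinear_relations_def by blast
    then show "free_basis (Word [x + y]) - (free_basis (Word [x]) + free_basis (Word [y]))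
        \<in> cspan multilinear_relations"
      by (simp add: complex_vector.span_base diff_diff_eq)
  qed
  then show ?thesis
    by (simp add: uea_gen.abs_eq plus_uea.abs_eq)
qed

lemma uea_gen_scaleR: "uea_gen (r *\<^sub>R x) = complex_of_real r *\<^sub>C uea_gen x"
proof -
  have "tensor_gen (r *\<^sub>R x) = complex_of_real r *\<^sub>C tensor_gen x"
  proof transfer
    fix r and x :: 'a
    have "free_basis (Word ([] @ [r *\<^sub>R x] @ []))
        - complex_of_real r *\<^sub>C free_basis (Word ([] @ [x] @ [])) \<in> multilinear_relations"
      unfolding multilinear_relations_def by blast
    then show "free_basis (Word [r *\<^sub>R x]) - complex_of_real r *\<^sub>C free_basis (Word [x])
        \<in> cspan multilinear_relations"
      by (simp add: complex_vector.span_base)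
  qed
  then show ?thesis
    by (simp add: uea_gen.abs_eq scaleC_uea.abs_eq)
qed

lemma uea_gen_bracket: "uea_gen \<lbrakk>x, y\<rbrakk>\<^sub>L = uea_gen x * uea_gen y - uea_gen y * uea_gen x"
proof -
  have "uea_gen x * uea_gen y - uea_gen y * uea_gen x = uea_gen \<lbrakk>x, y\<rbrakk>\<^sub>L"
    by transfer (unfold uea_ideal_def, rule hull_inc, blast)
  then show ?thesis by simp
qed

definition word_prod :: "('g \<Rightarrow> 'a::monoid_mult) \<Rightarrow> 'g fword \<Rightarrow> 'a" where
  "word_prod f w = prod_list (map f (letters w))"

definition linear_to_complex :: "('g::real_vector \<Rightarrow> 'a::complex_vector) \<Rightarrow> bool" where
  "linear_to_complex f \<longleftrightarrow>
    (\<forall>x y. f (x + y) = f x + f y) \<and> (\<forall>r x. f (r *\<^sub>R x) = complex_of_real r *\<^sub>C f x)"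

definition lie_map :: "('g::lie_algebra \<Rightarrow> 'a::complex_algebra_1) \<Rightarrow> bool" where
  "lie_map f \<longleftrightarrow> linear_to_complex f \<and> (\<forall>x y. f \<lbrakk>x, y\<rbrakk>\<^sub>L = f x * f y - f y * f x)"

lemma clinear_vanishes_on_span:
  assumes "clinear f" "\<And>x. x \<in> S \<Longrightarrow> f x = 0" "x \<in> cspan S"
  shows "f x = 0"
  using assms(3)
  by (induction rule: complex_vector.span_induct_alt)
    (simp_all add: clinear_0 clinear_add clinear_scale assms)

lemma free_extend_word_prod_mult:
  fixes f :: "'g \<Rightarrow> 'a::complex_algebra_1"
  shows "free_extend (word_prod f) (p * q) = free_extend (word_prod f) p * free_extend (word_prod f) q"
  by (rule free_extend_mult) (simp add: word_prod_def plus_fword_def)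

lift_definition tensor_lift ::
  "('g::real_vector \<Rightarrow> 'a::complex_algebra_1) \<Rightarrow> 'g tensor_algebra \<Rightarrow> 'a"
  is "\<lambda>f p. if linear_to_complex f then free_extend (word_prod f) p else 0"
proof -
  fix f :: "'g \<Rightarrow> 'a" and p q :: "'g fword \<Rightarrow>\<^sub>0 complex"
  assume pq: "p - q \<in> cspan multilinear_relations"
  have "free_extend (word_prod f) (p - q) = 0" if f: "linear_to_complex f"
  proof (rule clinear_vanishes_on_span[OF clinear_free_extend _ pq])
    fix r :: "'g fword \<Rightarrow>\<^sub>0 complex" assume "r \<in> multilinear_relations"
    then consider us vs x y where "r = free_basis (Word (us @ [x + y] @ vs))
          - free_basis (Word (us @ [x] @ vs)) - free_basis (Word (us @ [y] @ vs))"
      | us vs c x where "r = free_basis (Word (us @ [c *\<^sub>R x] @ vs))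
          - complex_of_real c *\<^sub>C free_basis (Word (us @ [x] @ vs))"
      unfolding multilinear_relations_def by blast
    then show "free_extend (word_prod f) r = 0"
    proof cases
      case 1
      have "f (x + y) = f x + f y" using f by (simp add: linear_to_complex_def)
      then show ?thesis
        by (simp only: 1 clinear_diff[OF clinear_free_extend] free_extend_single scaleC_one
            word_prod_def fword.sel map_append prod_list.append list.map prod_list.Cons prod_list.Nil
            distrib_left distrib_right) simp
    next
      case 2
      have "f (c *\<^sub>R x) = complex_of_real c *\<^sub>C f x" using f by (simp add: linear_to_complex_def)
      then show ?thesis
        by (simp only: 2 clinear_diff[OF clinear_free_extend] clinear_scale[OF clinear_free_extend]
            free_extend_single scaleC_one word_prod_def fword.sel map_append prod_list.append list.map
            prod_list.Cons prod_list.Nil scaleC_mult_left scaleC_mult_right) simp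
    qed
  qed
  then show "(if linear_to_complex f then free_extend (word_prod f) p else 0) =
      (if linear_to_complex f then free_extend (word_prod f) q else 0)"
    by (simp add: clinear_diff[OF clinear_free_extend])
qed

lemma tensor_lift_hom:
  assumes "linear_to_complex f"
  shows "unital_algebra_hom (tensor_lift f)"
  unfolding unital_algebra_hom_def clinear_iff
proof (intro conjI allI)
  show "tensor_lift f 1 = 1"
    using assms by transfer
      (simp add: single_one[symmetric] word_prod_def zero_fword_def scaleC_one del: single_one)
qed (use assms in \<open>transfer; simp add: clinear_add[OF clinear_free_extend]
  clinear_scale[OF clinear_free_extend] free_extend_word_prod_mult\<close>)+

lemma tensor_lift_gen:
  "linear_to_complex f \<Longrightarrow> tensor_lift f (tensor_gen x) = f x"
  by transfer (simp add: word_prod_def scaleC_one)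

lift_definition uea_lift :: "('g::lie_algebra \<Rightarrow> 'a::complex_algebra_1) \<Rightarrow> 'g uea \<Rightarrow> 'a"
  is "\<lambda>f t. if lie_map f then tensor_lift f t else 0"
proof -
  fix f :: "'g \<Rightarrow> 'a" and p q :: "'g tensor_algebra"
  assume pq: "p - q \<in> uea_ideal"
  have "tensor_lift f (p - q) = 0 \<and> clinear (tensor_lift f)" if f: "lie_map f"
  proof
    have h: "unital_algebra_hom (tensor_lift f)" and l: "linear_to_complex f"
      using f tensor_lift_hom by (auto simp: lie_map_def)
    show c: "clinear (tensor_lift f)" using h by (simp add: unital_algebra_hom_def)
    show "tensor_lift f (p - q) = 0"
      using pq unfolding uea_ideal_def
    proof (induction rule: two_sided_ideal_hull_induct)
      case (base x)
      then show ?case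
        using f h l by (auto simp: clinear_diff[OF c] unital_algebra_hom_def tensor_lift_gen lie_map_def)
    qed (use h in \<open>auto simp: clinear_0[OF c] clinear_add[OF c] clinear_scale[OF c] unital_algebra_hom_def\<close>)
  qed
  then show "(if lie_map f then tensor_lift f p else 0) = (if lie_map f then tensor_lift f q else 0)"
    by (metis clinear_diff eq_iff_diff_eq_0)
qed

lemma uea_lift_abs: "lie_map f \<Longrightarrow> uea_lift f (abs_uea t) = tensor_lift f t"
  by (simp add: uea_lift.abs_eq)

lemma uea_lift_hom:
  assumes f: "lie_map f"
  shows "unital_algebra_hom (uea_lift f)"
proof -
  have h: "unital_algebra_hom (tensor_lift f)"
    using f by (simp add: lie_map_def tensor_lift_hom)
  then have c: "clinear (tensor_lift f)" by (simp add: unital_algebra_hom_def)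
  have "uea_lift f (x + y) = uea_lift f x + uea_lift f y \<and> uea_lift f (x * y) = uea_lift f x * uea_lift f y"
    for x y
  proof (induction x rule: uea.abs_induct; induction y rule: uea.abs_induct)
    fix s t
    show "uea_lift f (abs_uea s + abs_uea t) = uea_lift f (abs_uea s) + uea_lift f (abs_uea t) \<and>
        uea_lift f (abs_uea s * abs_uea t) = uea_lift f (abs_uea s) * uea_lift f (abs_uea t)"
      using h by (simp add: plus_uea.abs_eq times_uea.abs_eq uea_lift_abs[OF f] clinear_add[OF c]
          unital_algebra_hom_def)
  qed
  moreover have "uea_lift f (a *\<^sub>C x) = a *\<^sub>C uea_lift f x" for a x
    by (induction x rule: uea.abs_induct)
      (simp add: scaleC_uea.abs_eq uea_lift_abs[OF f] clinear_scale[OF c])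
  moreover have "uea_lift f 1 = 1"
    using h by (simp add: one_uea.abs_eq uea_lift_abs[OF f] unital_algebra_hom_def)
  ultimately show ?thesis by (simp add: unital_algebra_hom_def clinear_iff)
qed

lemma uea_lift_gen: "lie_map f \<Longrightarrow> uea_lift f (uea_gen x) = f x"
  by (simp add: uea_gen.abs_eq uea_lift_abs tensor_lift_gen lie_map_def)

lemma uea_induct:
  fixes E :: "'g::lie_algebra uea"
  assumes P1: "P 1" and add: "\<And>E F. P E \<Longrightarrow> P F \<Longrightarrow> P (E + F)"
    and scale: "\<And>c E. P E \<Longrightarrow> P (c *\<^sub>C E)"
    and mult: "\<And>x E. P E \<Longrightarrow> P (uea_gen x * E)"
  shows "P E"
proof -
  have tw: "P (abs_uea (abs_tensor_algebra (free_basis (Word xs))))" for xs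
  proof (induction xs)
    case Nil
    have "abs_uea (abs_tensor_algebra (free_basis (Word []))) = (1 :: 'g uea)"
      by (simp add: one_uea.abs_eq one_tensor_algebra.abs_eq zero_fword_def[symmetric])
    then show ?case using P1 by simp
  next
    case (Cons x xs)
    have "abs_uea (abs_tensor_algebra (free_basis (Word (x # xs)))) =
        uea_gen x * abs_uea (abs_tensor_algebra (free_basis (Word xs)))"
      by (simp add: uea_gen.abs_eq tensor_gen.abs_eq times_uea.abs_eq times_tensor_algebra.abs_eq
          plus_fword_def)
    then show ?case using mult[OF Cons] by simp
  qed
  have fr: "P (abs_uea (abs_tensor_algebra p))" for p
  proof (induction p rule: free_induct)
    case 1
    have "abs_uea (abs_tensor_algebra 0) = (0 :: 'g uea)"
      by (simp add: zero_uea.abs_eq zero_tensor_algebra.abs_eq)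
    then show ?case using scale[OF P1, of 0] by simp
  next
    case (2 p q)
    then show ?case
      using add by (simp add: plus_uea.abs_eq[symmetric] plus_tensor_algebra.abs_eq[symmetric])
  next
    case (3 k c)
    have "Poly_Mapping.single k c = c *\<^sub>C free_basis k" by (simp add: scaleC_single)
    then show ?case
      using scale[OF tw[of "letters k"], of c]
      by (simp add: scaleC_uea.abs_eq scaleC_tensor_algebra.abs_eq)
  qed
  have "P (abs_uea t)" for t
    by (induction t rule: tensor_algebra.abs_induct) (rule fr)
  then show ?thesis by (induction E rule: uea.abs_induct)
qed

lemma uea_hom_eqI:
  assumes "unital_algebra_hom \<phi>" "unital_algebra_hom \<psi>" "\<And>x. \<phi> (uea_gen x) = \<psi> (uea_gen x)"
  shows "\<phi> E = \<psi> E"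
  using assms
  by (induction E rule: uea_induct) (simp_all add: unital_algebra_hom_def clinear_add clinear_scale)


section \<open>Conjugation and involution\<close>

definition antilinear :: "('a::complex_vector \<Rightarrow> 'b::complex_vector) \<Rightarrow> bool" where
  "antilinear f \<longleftrightarrow> (\<forall>x y. f (x + y) = f x + f y) \<and> (\<forall>c x. f (c *\<^sub>C x) = cnj c *\<^sub>C f x)"

lemma antilinear_add: "antilinear f \<Longrightarrow> f (x + y) = f x + f y"
  and antilinear_scale: "antilinear f \<Longrightarrow> f (c *\<^sub>C x) = cnj c *\<^sub>C f x"
  by (simp_all add: antilinear_def)

lemma antilinear_diff:
  assumes "antilinear f" shows "f (x - y) = f x - f y"
  using antilinear_add[OF assms, of "x - y" y] by simp

lemma antilinear_0: "antilinear f \<Longrightarrow> f 0 = 0"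
  using antilinear_diff[of f 0 0] by simp

lemma antilinear_span:
  assumes "antilinear f" "csubspace T" "\<And>x. x \<in> S \<Longrightarrow> f x \<in> T" "x \<in> cspan S"
  shows "f x \<in> T"
  using assms(4)
  by (induction rule: complex_vector.span_induct_alt)
    (simp_all add: antilinear_0 antilinear_add antilinear_scale assms
      complex_vector.subspace_0 complex_vector.subspace_add complex_vector.subspace_scale)

definition free_conj :: "('k \<Rightarrow>\<^sub>0 complex) \<Rightarrow> ('k \<Rightarrow>\<^sub>0 complex)" where
  "free_conj p = Poly_Mapping.map cnj p"

lemma lookup_free_conj: "Poly_Mapping.lookup (free_conj p) k = cnj (Poly_Mapping.lookup p k)"
  by (simp add: free_conj_def Poly_Mapping.map.rep_eq when_def)

lemma free_conj_antilinear: "antilinear free_conj"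
  unfolding antilinear_def
  by (auto intro!: poly_mapping_eqI simp: lookup_free_conj lookup_add)

lemma free_conj_single [simp]: "free_conj (Poly_Mapping.single k c) = Poly_Mapping.single k (cnj c)"
  by (rule poly_mapping_eqI) (simp add: lookup_free_conj lookup_single when_def)

lemma free_conj_mult:
  fixes p q :: "'k::monoid_add \<Rightarrow>\<^sub>0 complex"
  shows "free_conj (p * q) = free_conj p * free_conj q"
proof (induction p rule: free_induct)
  case (3 k c)
  show ?case
    by (induction q rule: free_induct)
      (simp_all add: antilinear_0[OF free_conj_antilinear] antilinear_add[OF free_conj_antilinear]
        mult_single distrib_left)
qed (simp_all add: antilinear_0[OF free_conj_antilinear] antilinear_add[OF free_conj_antilinear]
    distrib_right)

definition signed_reversal :: "'g fword \<Rightarrow> ('g fword \<Rightarrow>\<^sub>0 complex)" where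
  "signed_reversal w = Poly_Mapping.single (Word (rev (letters w))) ((- 1) ^ length (letters w))"

definition free_dagger :: "('g fword \<Rightarrow>\<^sub>0 complex) \<Rightarrow> ('g fword \<Rightarrow>\<^sub>0 complex)" where
  "free_dagger p = free_extend signed_reversal (free_conj p)"

lemma free_dagger_antilinear: "antilinear free_dagger"
  unfolding antilinear_def free_dagger_def
  by (simp add: antilinear_add[OF free_conj_antilinear] antilinear_scale[OF free_conj_antilinear]
      clinear_add[OF clinear_free_extend] clinear_scale[OF clinear_free_extend])

lemma free_dagger_single [simp]:
  "free_dagger (Poly_Mapping.single w c) =
    Poly_Mapping.single (Word (rev (letters w))) (cnj c * (- 1) ^ length (letters w))"
  by (simp add: free_dagger_def signed_reversal_def scaleC_single)

lemma free_dagger_mult: "free_dagger (p * q) = free_dagger q * free_dagger p"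
proof (induction p rule: free_induct)
  case (3 k c)
  show ?case
    by (induction q rule: free_induct)
      (simp_all add: antilinear_0[OF free_dagger_antilinear] antilinear_add[OF free_dagger_antilinear]
        mult_single distrib_left distrib_right plus_fword_def power_add mult_ac)
qed (simp_all add: antilinear_0[OF free_dagger_antilinear] antilinear_add[OF free_dagger_antilinear]
    distrib_left distrib_right)

lemma free_conj_relations:
  fixes r :: "'g::real_vector fword \<Rightarrow>\<^sub>0 complex"
  assumes "r \<in> multilinear_relations"
  shows "free_conj r \<in> cspan multilinear_relations"
proof -
  consider us vs x y where "r = free_basis (Word (us @ [x + y] @ vs)) - free_basis (Word (us @ [x] @ vs))
        - free_basis (Word (us @ [y] @ vs))"
    | us vs c x where "r = free_basis (Word (us @ [c *\<^sub>R x] @ vs))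
        - complex_of_real c *\<^sub>C free_basis (Word (us @ [x] @ vs))"
    using assms unfolding multilinear_relations_def by blast
  then have "free_conj r = r"
    by cases (simp_all only: antilinear_diff[OF free_conj_antilinear] free_conj_single complex_cnj_one
        antilinear_scale[OF free_conj_antilinear] complex_cnj_complex_of_real)
  then show ?thesis using assms by (simp add: complex_vector.span_base)
qed

lemma free_dagger_relations:
  fixes r :: "'g::real_vector fword \<Rightarrow>\<^sub>0 complex"
  assumes "r \<in> multilinear_relations"
  shows "free_dagger r \<in> cspan multilinear_relations"
proof -
  consider us vs x y where "r = free_basis (Word (us @ [x + y] @ vs)) - free_basis (Word (us @ [x] @ vs))
        - free_basis (Word (us @ [y] @ vs))"
    | us vs c x where "r = free_basis (Word (us @ [c *\<^sub>R x] @ vs))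
        - complex_of_real c *\<^sub>C free_basis (Word (us @ [x] @ vs))"
    using assms unfolding multilinear_relations_def by blast
  then show ?thesis
  proof cases
    case 1
    let ?s = "(- 1) ^ (length us + 1 + length vs) :: complex"
    have "free_dagger r = ?s *\<^sub>C (free_basis (Word (rev vs @ [x + y] @ rev us))
        - free_basis (Word (rev vs @ [x] @ rev us)) - free_basis (Word (rev vs @ [y] @ rev us)))"
      by (simp add: 1 antilinear_diff[OF free_dagger_antilinear] scaleC_single
          complex_vector.scale_right_diff_distrib)
    moreover have "free_basis (Word (rev vs @ [x + y] @ rev us))
        - free_basis (Word (rev vs @ [x] @ rev us)) - free_basis (Word (rev vs @ [y] @ rev us))
        \<in> multilinear_relations"
      unfolding multilinear_relations_def by blast
    ultimately show ?thesis by (simp only: complex_vector.span_base complex_vector.span_scale)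
  next
    case 2
    let ?s = "(- 1) ^ (length us + 1 + length vs) :: complex"
    have "free_dagger r = ?s *\<^sub>C (free_basis (Word (rev vs @ [c *\<^sub>R x] @ rev us))
        - complex_of_real c *\<^sub>C free_basis (Word (rev vs @ [x] @ rev us)))"
      by (simp add: 2 antilinear_diff[OF free_dagger_antilinear] scaleC_single mult_ac
          antilinear_scale[OF free_dagger_antilinear] complex_vector.scale_right_diff_distrib)
    moreover have "free_basis (Word (rev vs @ [c *\<^sub>R x] @ rev us))
        - complex_of_real c *\<^sub>C free_basis (Word (rev vs @ [x] @ rev us)) \<in> multilinear_relations"
      unfolding multilinear_relations_def by blast
    ultimately show ?thesis by (simp only: complex_vector.span_base complex_vector.span_scale)
  qed
qed

lift_definition tensor_conj :: "'g::real_vector tensor_algebra \<Rightarrow> 'g tensor_algebra" is free_conj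
  using antilinear_span[OF free_conj_antilinear complex_vector.subspace_span free_conj_relations]
  by (simp add: antilinear_diff[OF free_conj_antilinear, symmetric])

lift_definition tensor_dagger :: "'g::real_vector tensor_algebra \<Rightarrow> 'g tensor_algebra" is free_dagger
  using antilinear_span[OF free_dagger_antilinear complex_vector.subspace_span free_dagger_relations]
  by (simp add: antilinear_diff[OF free_dagger_antilinear, symmetric])

lemma tensor_conj_antilinear: "antilinear tensor_conj"
  unfolding antilinear_def
  by (intro conjI allI; transfer; rule csubspace_self[OF csubspace_ideal[OF multilinear_ideal]])
    (simp_all add: antilinear_add[OF free_conj_antilinear] antilinear_scale[OF free_conj_antilinear])

lemma tensor_dagger_antilinear: "antilinear tensor_dagger"
  unfolding antilinear_def
  by (intro conjI allI; transfer; rule csubspace_self[OF csubspace_ideal[OF multilinear_ideal]])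
    (simp_all add: antilinear_add[OF free_dagger_antilinear] antilinear_scale[OF free_dagger_antilinear])

lemma tensor_conj_mult: "tensor_conj (s * t) = tensor_conj s * tensor_conj t"
  by (transfer; rule csubspace_self[OF csubspace_ideal[OF multilinear_ideal]]) (rule free_conj_mult)

lemma tensor_dagger_mult: "tensor_dagger (s * t) = tensor_dagger t * tensor_dagger s"
  by (transfer; rule csubspace_self[OF csubspace_ideal[OF multilinear_ideal]]) (rule free_dagger_mult)

lemma tensor_conj_gen: "tensor_conj (tensor_gen x) = tensor_gen x"
  by (transfer; rule csubspace_self[OF csubspace_ideal[OF multilinear_ideal]]) simp

lemma tensor_dagger_gen: "tensor_dagger (tensor_gen x) = - tensor_gen x"
  by (transfer; rule csubspace_self[OF csubspace_ideal[OF multilinear_ideal]]) (simp add: single_uminus)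

lemma uea_idealD:
  "x \<in> uea_ideal \<Longrightarrow> y \<in> uea_ideal \<Longrightarrow> x + y \<in> uea_ideal"
  "x \<in> uea_ideal \<Longrightarrow> c *\<^sub>C x \<in> uea_ideal"
  "x \<in> uea_ideal \<Longrightarrow> a * x \<in> uea_ideal" "x \<in> uea_ideal \<Longrightarrow> x * a \<in> uea_ideal"
  "0 \<in> uea_ideal"
  using uea_ideal by (auto simp: two_sided_ideal_def csubspace_iff)

lemma uea_ideal_gen:
  "tensor_gen x * tensor_gen y - tensor_gen y * tensor_gen x - tensor_gen \<lbrakk>x, y\<rbrakk>\<^sub>L \<in> uea_ideal"
  unfolding uea_ideal_def by (rule hull_inc) blast

lemma tensor_conj_ideal:
  assumes "t \<in> uea_ideal" shows "tensor_conj t \<in> uea_ideal"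
proof (induction rule: two_sided_ideal_hull_induct[OF assms[unfolded uea_ideal_def]])
  case (1 t)
  then have "tensor_conj t = t"
    by (auto simp: antilinear_diff[OF tensor_conj_antilinear] tensor_conj_mult tensor_conj_gen)
  then show ?case using 1 by (simp add: hull_inc uea_ideal_def)
qed (simp_all add: tensor_conj_mult uea_idealD
    antilinear_0[OF tensor_conj_antilinear] antilinear_add[OF tensor_conj_antilinear]
    antilinear_scale[OF tensor_conj_antilinear])

lemma tensor_dagger_ideal:
  assumes "t \<in> uea_ideal" shows "tensor_dagger t \<in> uea_ideal"
proof (induction rule: two_sided_ideal_hull_induct[OF assms[unfolded uea_ideal_def]])
  case (1 t)
  then have "tensor_dagger t = (- 1) *\<^sub>C t"
    by (auto simp: antilinear_diff[OF tensor_dagger_antilinear] tensor_dagger_mult tensor_dagger_gen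
        complex_vector.scale_minus_left scaleC_one)
  then show ?case using uea_idealD(2)[of t "- 1"] 1 by (simp add: hull_inc uea_ideal_def)
qed (simp_all add: tensor_dagger_mult uea_idealD
    antilinear_0[OF tensor_dagger_antilinear] antilinear_add[OF tensor_dagger_antilinear]
    antilinear_scale[OF tensor_dagger_antilinear])

lift_definition uea_conj :: "'g::lie_algebra uea \<Rightarrow> 'g uea" is tensor_conj
  using tensor_conj_ideal by (simp add: antilinear_diff[OF tensor_conj_antilinear, symmetric])

lift_definition uea_dagger :: "'g::lie_algebra uea \<Rightarrow> 'g uea" is tensor_dagger
  using tensor_dagger_ideal by (simp add: antilinear_diff[OF tensor_dagger_antilinear, symmetric])

lemma uea_conj_antilinear: "antilinear uea_conj"
  unfolding antilinear_def
  by (intro conjI allI; transfer; rule csubspace_self[OF csubspace_ideal[OF uea_ideal]])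
    (simp_all add: antilinear_add[OF tensor_conj_antilinear] antilinear_scale[OF tensor_conj_antilinear])

lemma uea_dagger_antilinear: "antilinear uea_dagger"
  unfolding antilinear_def
  by (intro conjI allI; transfer; rule csubspace_self[OF csubspace_ideal[OF uea_ideal]])
    (simp_all add: antilinear_add[OF tensor_dagger_antilinear] antilinear_scale[OF tensor_dagger_antilinear])

lemma uea_conj_mult: "uea_conj (E * F) = uea_conj E * uea_conj F"
  by (transfer; rule csubspace_self[OF csubspace_ideal[OF uea_ideal]]) (rule tensor_conj_mult)

lemma uea_dagger_mult: "uea_dagger (E * F) = uea_dagger F * uea_dagger E"
  by (transfer; rule csubspace_self[OF csubspace_ideal[OF uea_ideal]]) (rule tensor_dagger_mult)

lemma uea_conj_gen: "uea_conj (uea_gen x) = uea_gen x"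
  by (simp add: uea_gen.abs_eq uea_conj.abs_eq tensor_conj_gen)

lemma uea_dagger_gen: "uea_dagger (uea_gen x) = - uea_gen x"
  by (simp add: uea_gen.abs_eq uea_dagger.abs_eq tensor_dagger_gen uminus_uea.abs_eq)

lemma uea_conj_1: "uea_conj 1 = 1"
proof -
  have "tensor_conj 1 = (1 :: 'a tensor_algebra)"
    by (transfer; rule csubspace_self[OF csubspace_ideal[OF multilinear_ideal]])
      (simp add: single_one[symmetric] del: single_one)
  then show ?thesis by (simp add: one_uea.abs_eq uea_conj.abs_eq)
qed

lemma uea_dagger_1: "uea_dagger 1 = 1"
proof -
  have "tensor_dagger 1 = (1 :: 'a tensor_algebra)"
    by (transfer; rule csubspace_self[OF csubspace_ideal[OF multilinear_ideal]])
      (simp add: single_one[symmetric] zero_fword_def del: single_one)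
  then show ?thesis by (simp add: one_uea.abs_eq uea_dagger.abs_eq)
qed

lemma uea_conj_word: "uea_conj (prod_list (map uea_gen xs)) = prod_list (map uea_gen xs)"
  by (induction xs) (simp_all add: uea_conj_1 uea_conj_mult uea_conj_gen)

lemma uea_dagger_word:
  "uea_dagger (prod_list (map uea_gen xs)) = (- 1) ^ length xs *\<^sub>C prod_list (map uea_gen (rev xs))"
  by (induction xs)
    (simp_all add: uea_dagger_1 uea_dagger_mult uea_dagger_gen scaleC_one scaleC_mult_left
      complex_vector.scale_minus_left)

lemma uea_conj_conj: "uea_conj (uea_conj E) = E"
  by (induction E rule: uea_induct)
    (simp_all add: uea_conj_1 uea_conj_mult uea_conj_gen antilinear_add[OF uea_conj_antilinear]
      antilinear_scale[OF uea_conj_antilinear])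

definition uea_real :: "'g::lie_algebra uea set" where
  "uea_real = {E. uea_conj E = E}"


section \<open>Tensor products\<close>

datatype ('a, 'b) tpair = TPair (left_factor: 'a) (right_factor: 'b)

instantiation tpair :: (monoid_mult, monoid_mult) monoid_add
begin
definition zero_tpair :: "('a, 'b) tpair" where "0 = TPair 1 1"
definition plus_tpair :: "('a, 'b) tpair \<Rightarrow> ('a, 'b) tpair \<Rightarrow> ('a, 'b) tpair" where
  "p + q = TPair (left_factor p * left_factor q) (right_factor p * right_factor q)"
instance by standard (simp_all add: zero_tpair_def plus_tpair_def mult.assoc)
end

definition bilinear_relations :: "(('a::complex_vector, 'b::complex_vector) tpair \<Rightarrow>\<^sub>0 complex) set" where
  "bilinear_relations =
    {free_basis (TPair (x + x') y) - free_basis (TPair x y) - free_basis (TPair x' y) | x x' y. True} \<union>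
    {free_basis (TPair x (y + y')) - free_basis (TPair x y) - free_basis (TPair x y') | x y y'. True} \<union>
    {free_basis (TPair (c *\<^sub>C x) y) - c *\<^sub>C free_basis (TPair x y) | c x y. True} \<union>
    {free_basis (TPair x (c *\<^sub>C y)) - c *\<^sub>C free_basis (TPair x y) | c x y. True}"

lemma bilinear_relations_cases:
  assumes "r \<in> bilinear_relations"
  obtains (add_left) x x' y where
      "r = free_basis (TPair (x + x') y) - free_basis (TPair x y) - free_basis (TPair x' y)"
    | (add_right) x y y' where
      "r = free_basis (TPair x (y + y')) - free_basis (TPair x y) - free_basis (TPair x y')"
    | (scale_left) c x y where "r = free_basis (TPair (c *\<^sub>C x) y) - c *\<^sub>C free_basis (TPair x y)"
    | (scale_right) c x y where "r = free_basis (TPair x (c *\<^sub>C y)) - c *\<^sub>C free_basis (TPair x y)"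
  using assms unfolding bilinear_relations_def by blast

lemma bilinear_relations_intros:
  "free_basis (TPair (x + x') y) - free_basis (TPair x y) - free_basis (TPair x' y) \<in> bilinear_relations"
  "free_basis (TPair x (y + y')) - free_basis (TPair x y) - free_basis (TPair x y') \<in> bilinear_relations"
  "free_basis (TPair (c *\<^sub>C x) y) - c *\<^sub>C free_basis (TPair x y) \<in> bilinear_relations"
  "free_basis (TPair x (c *\<^sub>C y)) - c *\<^sub>C free_basis (TPair x y) \<in> bilinear_relations"
  unfolding bilinear_relations_def by blast+

lemma bilinear_relations_mult:
  fixes r :: "('a::complex_algebra_1, 'b::complex_algebra_1) tpair \<Rightarrow>\<^sub>0 complex"
  assumes "r \<in> bilinear_relations"
  shows "free_basis k * r \<in> bilinear_relations" "r * free_basis k \<in> bilinear_relations"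
proof -
  obtain a b where k: "k = TPair a b" by (cases k)
  have "free_basis k * r \<in> bilinear_relations \<and> r * free_basis k \<in> bilinear_relations"
    using assms
    by (cases rule: bilinear_relations_cases)
      (simp_all add: k right_diff_distrib left_diff_distrib plus_tpair_def distrib_left distrib_right
        scaleC_mult_left scaleC_mult_right bilinear_relations_intros del: scaleC_complex_def)
  then show "free_basis k * r \<in> bilinear_relations" "r * free_basis k \<in> bilinear_relations" by auto
qed

lemma bilinear_ideal:
  "two_sided_ideal (cspan (bilinear_relations ::
    (('a::complex_algebra_1, 'b::complex_algebra_1) tpair \<Rightarrow>\<^sub>0 complex) set))"
  by (intro cspan_ideal bilinear_relations_mult)

quotient_type (overloaded) ('a, 'b) ctensor =
  "('a::complex_vector, 'b::complex_vector) tpair \<Rightarrow>\<^sub>0 complex" / "\<lambda>p q. p - q \<in> cspan bilinear_relations"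
  by (rule equivp_csubspace[OF complex_vector.subspace_span])

instantiation ctensor :: (complex_vector, complex_vector) complex_vector
begin
lift_definition zero_ctensor :: "('a, 'b) ctensor" is 0 .
lift_definition plus_ctensor :: "('a, 'b) ctensor \<Rightarrow> ('a, 'b) ctensor \<Rightarrow> ('a, 'b) ctensor" is "(+)"
  by (rule csubspace_resp[OF complex_vector.subspace_span])
lift_definition minus_ctensor :: "('a, 'b) ctensor \<Rightarrow> ('a, 'b) ctensor \<Rightarrow> ('a, 'b) ctensor" is "(-)"
  by (rule csubspace_resp[OF complex_vector.subspace_span])
lift_definition uminus_ctensor :: "('a, 'b) ctensor \<Rightarrow> ('a, 'b) ctensor" is uminus
  by (rule csubspace_resp[OF complex_vector.subspace_span])
lift_definition scaleC_ctensor :: "complex \<Rightarrow> ('a, 'b) ctensor \<Rightarrow> ('a, 'b) ctensor" is scaleC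
  by (rule csubspace_resp[OF complex_vector.subspace_span])
instance
  by standard (transfer; rule csubspace_self[OF complex_vector.subspace_span];
      simp add: algebra_simps scaleC_add_right scaleC_add_left scaleC_scaleC scaleC_one)+
end

instantiation ctensor :: (complex_algebra_1, complex_algebra_1) complex_algebra_1
begin
lift_definition one_ctensor :: "('a, 'b) ctensor" is 1 .
lift_definition times_ctensor :: "('a, 'b) ctensor \<Rightarrow> ('a, 'b) ctensor \<Rightarrow> ('a, 'b) ctensor" is "(*)"
  by (rule two_sided_ideal_resp[OF bilinear_ideal])
instance
  by standard (transfer; rule csubspace_self[OF complex_vector.subspace_span];
      simp add: algebra_simps scaleC_mult_left scaleC_mult_right)+
end

lift_definition tensor_pure :: "'a::complex_vector \<Rightarrow> 'b::complex_vector \<Rightarrow> ('a, 'b) ctensor"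
  (infixr \<open>\<otimes>\<^sub>C\<close> 76) is "\<lambda>x y. free_basis (TPair x y)" .

lemma tensor_pure_add_left: "(x + x') \<otimes>\<^sub>C y = x \<otimes>\<^sub>C y + x' \<otimes>\<^sub>C y"
  by transfer (use complex_vector.span_base[OF bilinear_relations_intros(1)] in \<open>simp add: diff_diff_eq\<close>)

lemma tensor_pure_add_right: "x \<otimes>\<^sub>C (y + y') = x \<otimes>\<^sub>C y + x \<otimes>\<^sub>C y'"
  by transfer (use complex_vector.span_base[OF bilinear_relations_intros(2)] in \<open>simp add: diff_diff_eq\<close>)

lemma tensor_pure_scale_left: "(c *\<^sub>C x) \<otimes>\<^sub>C y = c *\<^sub>C (x \<otimes>\<^sub>C y)"
  by transfer (rule complex_vector.span_base[OF bilinear_relations_intros(3)])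

lemma tensor_pure_scale_right: "x \<otimes>\<^sub>C (c *\<^sub>C y) = c *\<^sub>C (x \<otimes>\<^sub>C y)"
  by transfer (rule complex_vector.span_base[OF bilinear_relations_intros(4)])

lemma tensor_pure_0: "0 \<otimes>\<^sub>C y = 0" "x \<otimes>\<^sub>C 0 = 0"
  using tensor_pure_scale_left[of 0 0 y] tensor_pure_scale_right[of x 0 0] by simp_all

lemma tensor_pure_diff_left: "(x - x') \<otimes>\<^sub>C y = x \<otimes>\<^sub>C y - x' \<otimes>\<^sub>C y"
  using tensor_pure_add_left[of "x - x'" x' y] by simp

lemma tensor_pure_diff_right: "x \<otimes>\<^sub>C (y - y') = x \<otimes>\<^sub>C y - x \<otimes>\<^sub>C y'"
  using tensor_pure_add_right[of x "y - y'" y'] by simp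

lemma tensor_pure_mult: "(x \<otimes>\<^sub>C y) * (x' \<otimes>\<^sub>C y') = (x * x') \<otimes>\<^sub>C (y * y')"
  by (simp add: tensor_pure.abs_eq times_ctensor.abs_eq plus_tpair_def)

lemma tensor_pure_1: "1 \<otimes>\<^sub>C 1 = 1"
  by (simp add: tensor_pure.abs_eq one_ctensor.abs_eq zero_tpair_def[symmetric])

lemma ctensor_induct [case_names add pure]:
  assumes add: "\<And>s t. P s \<Longrightarrow> P t \<Longrightarrow> P (s + t)" and pure: "\<And>x y. P (x \<otimes>\<^sub>C y)"
  shows "P t"
proof (induction t rule: ctensor.abs_induct)
  fix p :: "('a, 'b) tpair \<Rightarrow>\<^sub>0 complex"
  show "P (abs_ctensor p)"
  proof (induction p rule: free_induct)
    case 1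
    show ?case using pure[of 0 0] by (simp add: tensor_pure_0 zero_ctensor.abs_eq)
  next
    case (2 p q)
    then show ?case using add by (simp add: plus_ctensor.abs_eq[symmetric])
  next
    case (3 k c)
    have "Poly_Mapping.single k c = c *\<^sub>C free_basis k" by (simp add: scaleC_single)
    then have "abs_ctensor (Poly_Mapping.single k c) = c *\<^sub>C (left_factor k \<otimes>\<^sub>C right_factor k)"
      by (simp add: tensor_pure.abs_eq scaleC_ctensor.abs_eq)
    then show ?case using pure by (simp add: tensor_pure_scale_left[symmetric])
  qed
qed

definition cbilinear :: "('a::complex_vector \<Rightarrow> 'b::complex_vector \<Rightarrow> 'c::complex_vector) \<Rightarrow> bool" where
  "cbilinear f \<longleftrightarrow> (\<forall>x. clinear (f x)) \<and> (\<forall>y. clinear (\<lambda>x. f x y))"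

lift_definition ctensor_lift ::
  "('a::complex_vector \<Rightarrow> 'b::complex_vector \<Rightarrow> 'c::complex_vector) \<Rightarrow> ('a, 'b) ctensor \<Rightarrow> 'c"
  is "\<lambda>f p. if cbilinear f then free_extend (\<lambda>k. f (left_factor k) (right_factor k)) p else 0"
proof -
  fix f :: "'a \<Rightarrow> 'b \<Rightarrow> 'c" and p q :: "('a, 'b) tpair \<Rightarrow>\<^sub>0 complex"
  assume pq: "p - q \<in> cspan bilinear_relations"
  let ?f = "\<lambda>k. f (left_factor k) (right_factor k)"
  have "free_extend ?f (p - q) = 0" if f: "cbilinear f"
  proof (rule clinear_vanishes_on_span[OF clinear_free_extend _ pq])
    have f': "f (x + x') y = f x y + f x' y" "f x (y + y') = f x y + f x y'"
      "f (c *\<^sub>C x) y = c *\<^sub>C f x y" "f x (c *\<^sub>C y) = c *\<^sub>C f x y" for x x' y y' c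
      using f by (simp_all add: cbilinear_def clinear_iff)
    fix r :: "('a, 'b) tpair \<Rightarrow>\<^sub>0 complex" assume "r \<in> bilinear_relations"
    then show "free_extend ?f r = 0"
      by (cases rule: bilinear_relations_cases)
        (simp_all add: clinear_diff[OF clinear_free_extend] clinear_scale[OF clinear_free_extend]
          scaleC_one f' del: scaleC_complex_def)
  qed
  then show "(if cbilinear f then free_extend ?f p else 0) = (if cbilinear f then free_extend ?f q else 0)"
    by (simp add: clinear_diff[OF clinear_free_extend])
qed

lemma ctensor_lift_pure: "cbilinear f \<Longrightarrow> ctensor_lift f (x \<otimes>\<^sub>C y) = f x y"
  by (simp add: tensor_pure.abs_eq ctensor_lift.abs_eq scaleC_one)

lemma clinear_ctensor_lift: "clinear (ctensor_lift f)"
proof (cases "cbilinear f")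
  case True
  then have l: "ctensor_lift f (abs_ctensor p) = free_extend (\<lambda>k. f (left_factor k) (right_factor k)) p" for p
    by (simp add: ctensor_lift.abs_eq)
  have "ctensor_lift f (s + t) = ctensor_lift f s + ctensor_lift f t" for s t
  proof (induction s rule: ctensor.abs_induct; induction t rule: ctensor.abs_induct)
    fix p q
    show "ctensor_lift f (abs_ctensor p + abs_ctensor q)
        = ctensor_lift f (abs_ctensor p) + ctensor_lift f (abs_ctensor q)"
      by (simp add: l plus_ctensor.abs_eq clinear_add[OF clinear_free_extend])
  qed
  moreover have "ctensor_lift f (c *\<^sub>C t) = c *\<^sub>C ctensor_lift f t" for c t
    by (induction t rule: ctensor.abs_induct)
      (simp add: l scaleC_ctensor.abs_eq clinear_scale[OF clinear_free_extend])
  ultimately show ?thesis by (simp add: clinear_iff)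
next
  case False
  then have "ctensor_lift f t = 0" for t
    by (induction t rule: ctensor.abs_induct) (simp add: ctensor_lift.abs_eq)
  then show ?thesis by (simp add: clinear_iff)
qed


section \<open>Coproduct and dual algebra\<close>

definition coproduct :: "'g::lie_algebra uea \<Rightarrow> ('g uea, 'g uea) ctensor" where
  "coproduct = uea_lift (\<lambda>x. 1 \<otimes>\<^sub>C uea_gen x + uea_gen x \<otimes>\<^sub>C 1)"

lemma lie_map_coproduct:
  "lie_map (\<lambda>x::'g::lie_algebra. 1 \<otimes>\<^sub>C uea_gen x + uea_gen x \<otimes>\<^sub>C 1)"
  unfolding lie_map_def linear_to_complex_def
proof (intro conjI allI)
  fix x y :: 'g
  show "1 \<otimes>\<^sub>C uea_gen (x + y) + uea_gen (x + y) \<otimes>\<^sub>C 1 =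
      (1 \<otimes>\<^sub>C uea_gen x + uea_gen x \<otimes>\<^sub>C 1) + (1 \<otimes>\<^sub>C uea_gen y + uea_gen y \<otimes>\<^sub>C 1)"
    by (simp add: uea_gen_add tensor_pure_add_left tensor_pure_add_right)
  show "1 \<otimes>\<^sub>C uea_gen \<lbrakk>x, y\<rbrakk>\<^sub>L + uea_gen \<lbrakk>x, y\<rbrakk>\<^sub>L \<otimes>\<^sub>C 1 =
      (1 \<otimes>\<^sub>C uea_gen x + uea_gen x \<otimes>\<^sub>C 1) * (1 \<otimes>\<^sub>C uea_gen y + uea_gen y \<otimes>\<^sub>C 1) -
      (1 \<otimes>\<^sub>C uea_gen y + uea_gen y \<otimes>\<^sub>C 1) * (1 \<otimes>\<^sub>C uea_gen x + uea_gen x \<otimes>\<^sub>C 1)"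
    by (simp add: uea_gen_bracket tensor_pure_diff_left tensor_pure_diff_right distrib_left distrib_right
        tensor_pure_mult)
next
  fix r and x :: 'g
  show "1 \<otimes>\<^sub>C uea_gen (r *\<^sub>R x) + uea_gen (r *\<^sub>R x) \<otimes>\<^sub>C 1 =
      complex_of_real r *\<^sub>C (1 \<otimes>\<^sub>C uea_gen x + uea_gen x \<otimes>\<^sub>C 1)"
    by (simp add: uea_gen_scaleR tensor_pure_scale_left tensor_pure_scale_right scaleC_add_right)
qed

lemma coproduct_hom: "unital_algebra_hom coproduct"
  unfolding coproduct_def by (rule uea_lift_hom[OF lie_map_coproduct])

lemma coproduct_gen: "coproduct (uea_gen x) = 1 \<otimes>\<^sub>C uea_gen x + uea_gen x \<otimes>\<^sub>C 1"
  unfolding coproduct_def by (rule uea_lift_gen[OF lie_map_coproduct])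

lemma coproduct_unique:
  assumes "unital_algebra_hom \<phi>" "\<And>x. \<phi> (uea_gen x) = 1 \<otimes>\<^sub>C uea_gen x + uea_gen x \<otimes>\<^sub>C 1"
  shows "\<phi> = coproduct"
  by (rule ext, rule uea_hom_eqI[OF assms(1) coproduct_hom]) (simp add: assms(2) coproduct_gen)

definition counit :: "'g::lie_algebra uea \<Rightarrow> complex" where
  "counit = uea_lift (\<lambda>x. 0)"

lemma lie_map_counit: "lie_map (\<lambda>x::'g::lie_algebra. 0 :: complex)"
  by (simp add: lie_map_def linear_to_complex_def)

lemma counit_hom: "unital_algebra_hom counit"
  unfolding counit_def by (rule uea_lift_hom[OF lie_map_counit])

lemma counit_gen: "counit (uea_gen x) = 0"
  unfolding counit_def by (rule uea_lift_gen[OF lie_map_counit])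

definition uea_dual :: "('g::lie_algebra uea \<Rightarrow> complex) set" where
  "uea_dual = {a. clinear a}"

definition functional_tensor ::
  "('a::complex_vector \<Rightarrow> complex) \<Rightarrow> ('b::complex_vector \<Rightarrow> complex) \<Rightarrow> ('a, 'b) ctensor \<Rightarrow> complex" where
  "functional_tensor a b = ctensor_lift (\<lambda>x y. a x * b y)"

lemma functional_tensor_pure:
  "clinear a \<Longrightarrow> clinear b \<Longrightarrow> functional_tensor a b (x \<otimes>\<^sub>C y) = a x * b y"
  unfolding functional_tensor_def
  by (rule ctensor_lift_pure) (simp add: cbilinear_def clinear_iff algebra_simps)

definition dual_mult ::
  "('g::lie_algebra uea \<Rightarrow> complex) \<Rightarrow> ('g uea \<Rightarrow> complex) \<Rightarrow> 'g uea \<Rightarrow> complex" where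
  "dual_mult a b = functional_tensor a b \<circ> coproduct"

lemma dual_mult_closed:
  fixes a b :: "'g::lie_algebra uea \<Rightarrow> complex"
  shows "dual_mult a b \<in> uea_dual"
proof -
  have c: "clinear (coproduct :: 'g uea \<Rightarrow> _)"
    by (rule coproduct_hom[unfolded unital_algebra_hom_def, THEN conjunct1])
  have f: "clinear (functional_tensor a b)"
    unfolding functional_tensor_def by (rule clinear_ctensor_lift)
  show ?thesis
    unfolding uea_dual_def dual_mult_def mem_Collect_eq
    by (rule Vector_Spaces.linear_compose[OF c f])
qed

lemma counit_coproduct:
  fixes E :: "'a::lie_algebra uea"
  shows "ctensor_lift (\<lambda>D E. counit D *\<^sub>C E) (coproduct E) = E" (is "?l (coproduct E) = E")
    and "ctensor_lift (\<lambda>D E. counit E *\<^sub>C D) (coproduct E) = E" (is "?r (coproduct E) = E")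
proof -
  have c: "clinear (counit :: 'a uea \<Rightarrow> _)" and c1: "counit (1 :: 'a uea) = 1" and cm: "counit (D * E) = counit D * counit E"
    for D E :: "'a uea"
    using counit_hom by (auto simp: unital_algebra_hom_def)
  have dc: "clinear (coproduct :: 'a uea \<Rightarrow> _)" "coproduct (1 :: 'a uea) = 1" "coproduct (D * E) = coproduct D * coproduct E"
    for D E :: "'a uea"
    using coproduct_hom by (auto simp: unital_algebra_hom_def)
  have p: "?l (D \<otimes>\<^sub>C E) = counit D *\<^sub>C E" "?r (D \<otimes>\<^sub>C E) = counit E *\<^sub>C D" for D E :: "'a uea"
    by (rule ctensor_lift_pure, simp add: cbilinear_def clinear_iff clinear_add[OF c] clinear_scale[OF c]
        scaleC_add_left scaleC_add_right scaleC_scaleC mult.commute)+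
  note add = clinear_add[OF clinear_ctensor_lift]
  have m: "?l (s * t) = ?l s * ?l t" "?r (s * t) = ?r s * ?r t" for s t :: "('a uea, 'a uea) ctensor"
  proof -
    have "?l (s * t) = ?l s * ?l t \<and> ?r (s * t) = ?r s * ?r t"
    proof (induction s rule: ctensor_induct)
      case (pure D E)
      show ?case
        by (induction t rule: ctensor_induct)
          (simp_all add: add distrib_left tensor_pure_mult p cm scaleC_mult_left scaleC_mult_right
            scaleC_scaleC mult.commute)
    qed (simp add: add distrib_right)
    then show "?l (s * t) = ?l s * ?l t" "?r (s * t) = ?r s * ?r t" by auto
  qed
  have i: "unital_algebra_hom (\<lambda>E::'a uea. E)"
    by (simp add: unital_algebra_hom_def clinear_iff)
  have l: "unital_algebra_hom (\<lambda>E. ?l (coproduct E))"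
    by (simp add: unital_algebra_hom_def clinear_iff clinear_add[OF dc(1)] clinear_scale[OF dc(1)]
        dc(2,3) add clinear_scale[OF clinear_ctensor_lift] m tensor_pure_1[symmetric] p c1 scaleC_one)
  have r: "unital_algebra_hom (\<lambda>E. ?r (coproduct E))"
    by (simp add: unital_algebra_hom_def clinear_iff clinear_add[OF dc(1)] clinear_scale[OF dc(1)]
        dc(2,3) add clinear_scale[OF clinear_ctensor_lift] m tensor_pure_1[symmetric] p c1 scaleC_one)
  show "?l (coproduct E) = E"
    by (rule uea_hom_eqI[OF l i]) (simp add: coproduct_gen add p counit_gen c1 scaleC_one)
  show "?r (coproduct E) = E"
    by (rule uea_hom_eqI[OF r i]) (simp add: coproduct_gen add p counit_gen c1 scaleC_one)
qed

lemma dual_mult_counit: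
  fixes a :: "'a::lie_algebra uea \<Rightarrow> complex"
  assumes "a \<in> uea_dual"
  shows "dual_mult counit a = a" "dual_mult a counit = a"
proof -
  have a: "clinear a" using assms by (simp add: uea_dual_def)
  have c: "clinear (counit :: 'a uea \<Rightarrow> _)"
    by (rule counit_hom[unfolded unital_algebra_hom_def, THEN conjunct1])
  have cb: "cbilinear (\<lambda>(D::'a uea) (E::'a uea). counit D *\<^sub>C E)"
    "cbilinear (\<lambda>(D::'a uea) (E::'a uea). counit E *\<^sub>C D)"
    by (simp_all add: cbilinear_def clinear_iff clinear_add[OF c] clinear_scale[OF c]
        scaleC_add_left scaleC_add_right scaleC_scaleC mult.commute)
  have lin: "functional_tensor f g (s + t) = functional_tensor f g s + functional_tensor f g t"
    for f g :: "'a uea \<Rightarrow> complex" and s t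
    unfolding functional_tensor_def by (rule clinear_add[OF clinear_ctensor_lift])
  have "functional_tensor counit a t = a (ctensor_lift (\<lambda>D E. counit D *\<^sub>C E) t)"
    for t :: "('a uea, 'a uea) ctensor"
    by (induction t rule: ctensor_induct)
      (simp_all add: lin clinear_add[OF clinear_ctensor_lift] clinear_add[OF a] clinear_scale[OF a]
        functional_tensor_pure[OF c a] ctensor_lift_pure[OF cb(1)])
  moreover have "functional_tensor a counit t = a (ctensor_lift (\<lambda>D E. counit E *\<^sub>C D) t)"
    for t :: "('a uea, 'a uea) ctensor"
    by (induction t rule: ctensor_induct)
      (simp_all add: lin clinear_add[OF clinear_ctensor_lift] clinear_add[OF a] clinear_scale[OF a]
        functional_tensor_pure[OF a c] ctensor_lift_pure[OF cb(2)] mult.commute)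
  ultimately show "dual_mult counit a = a" "dual_mult a counit = a"
    by (simp_all add: dual_mult_def fun_eq_iff counit_coproduct)
qed

text \<open>
  Every \<open>G\<close> is \<open>E + \<i>F\<close> for the unique real elements \<open>E = uea_Re G\<close> and \<open>F = uea_Im G\<close>
  (\<open>uea_Re_Im\<close>, \<open>dual_dagger_real\<close>), so the involution of the dual is well defined on all \<open>G\<close>.
\<close>

definition uea_Re :: "'g::lie_algebra uea \<Rightarrow> 'g uea" where
  "uea_Re E = (1 / 2) *\<^sub>C (E + uea_conj E)"

definition uea_Im :: "'g::lie_algebra uea \<Rightarrow> 'g uea" where
  "uea_Im E = (1 / (2 * \<i>)) *\<^sub>C (E - uea_conj E)"

definition dual_dagger :: "('g::lie_algebra uea \<Rightarrow> complex) \<Rightarrow> 'g uea \<Rightarrow> complex" where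
  "dual_dagger a G = cnj (a (uea_Re G)) + \<i> * cnj (a (uea_Im G))"

lemma uea_Re_Im:
  "uea_Re E \<in> uea_real" "uea_Im E \<in> uea_real" "E = uea_Re E + \<i> *\<^sub>C uea_Im E"
proof -
  note conj = antilinear_add[OF uea_conj_antilinear] antilinear_diff[OF uea_conj_antilinear]
    antilinear_scale[OF uea_conj_antilinear] uea_conj_conj
  show "uea_Re E \<in> uea_real"
    by (simp add: uea_real_def uea_Re_def conj add.commute)
  have "uea_conj (uea_Im E) = (- (1 / (2 * \<i>))) *\<^sub>C (uea_conj E - E)"
    by (simp only: uea_Im_def conj) simp
  also have "\<dots> = uea_Im E"
    unfolding uea_Im_def complex_vector.scale_minus_left complex_vector.scale_minus_right[symmetric]
      minus_diff_eq ..
  finally show "uea_Im E \<in> uea_real" by (simp add: uea_real_def)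
  have "uea_Re E + \<i> *\<^sub>C uea_Im E = (1 / 2) *\<^sub>C ((E + uea_conj E) + (E - uea_conj E))"
    by (simp only: uea_Re_def uea_Im_def scaleC_scaleC scaleC_add_right) simp
  also have "\<dots> = (1 / 2) *\<^sub>C (2 *\<^sub>C E)"
    using scaleC_add_left[of 1 1 E] by (simp add: scaleC_one)
  also have "\<dots> = E" by (simp add: scaleC_scaleC scaleC_one)
  finally show "E = uea_Re E + \<i> *\<^sub>C uea_Im E" by simp
qed

lemma dual_dagger_real:
  assumes "E \<in> uea_real" "F \<in> uea_real"
  shows "dual_dagger a (E + \<i> *\<^sub>C F) = cnj (a E) + \<i> * cnj (a F)"
proof -
  have c: "uea_conj (E + \<i> *\<^sub>C F) = E - \<i> *\<^sub>C F"
    using assms by (simp add: uea_real_def antilinear_add[OF uea_conj_antilinear]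
        antilinear_scale[OF uea_conj_antilinear])
  have two: "D + D = 2 *\<^sub>C D" for D :: "'a uea"
    using scaleC_add_left[of 1 1 D] by (simp add: scaleC_one)
  have "uea_Re (E + \<i> *\<^sub>C F) = (1 / 2) *\<^sub>C (E + E)"
    by (simp only: uea_Re_def c) (simp add: algebra_simps)
  then have re: "uea_Re (E + \<i> *\<^sub>C F) = E"
    by (simp add: two scaleC_scaleC scaleC_one)
  have "uea_Im (E + \<i> *\<^sub>C F) = (1 / (2 * \<i>)) *\<^sub>C (\<i> *\<^sub>C F + \<i> *\<^sub>C F)"
    by (simp only: uea_Im_def c) (simp add: algebra_simps)
  then have "uea_Im (E + \<i> *\<^sub>C F) = F"
    by (simp add: two scaleC_scaleC scaleC_one)
  with re show ?thesis by (simp add: dual_dagger_def)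
qed

definition dual_act ::
  "'g::lie_algebra uea \<Rightarrow> ('g uea \<Rightarrow> complex) \<Rightarrow> 'g uea \<Rightarrow> complex" where
  "dual_act E a F = a (uea_dagger (uea_conj E) * F)"

text \<open>
  The unit of the dual algebra is \<^const>\<open>counit\<close>, by \<open>dual_mult_counit\<close>; sums and scalar
  multiples of functionals are pointwise.
\<close>

definition dual_unital_subalgebra :: "('g::lie_algebra uea \<Rightarrow> complex) set \<Rightarrow> bool" where
  "dual_unital_subalgebra B \<longleftrightarrow> B \<subseteq> uea_dual \<and> counit \<in> B \<and>
    (\<forall>a\<in>B. \<forall>b\<in>B. (\<lambda>E. a E + b E) \<in> B) \<and> (\<forall>c. \<forall>a\<in>B. (\<lambda>E. c * a E) \<in> B) \<and>
    (\<forall>a\<in>B. \<forall>b\<in>B. dual_mult a b \<in> B)"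

definition generated_involutive_subalgebra ::
  "('g::lie_algebra uea \<Rightarrow> complex) set \<Rightarrow> ('g uea \<Rightarrow> complex) set" where
  "generated_involutive_subalgebra S =
    (\<lambda>B. dual_unital_subalgebra B \<and> (\<forall>a\<in>B. dual_dagger a \<in> B)) hull S"

definition dual_submodule :: "('g::lie_algebra uea \<Rightarrow> complex) set \<Rightarrow> bool" where
  "dual_submodule M \<longleftrightarrow> M \<subseteq> uea_dual \<and> (\<lambda>E. 0) \<in> M \<and>
    (\<forall>a\<in>M. \<forall>b\<in>M. (\<lambda>E. a E + b E) \<in> M) \<and> (\<forall>c. \<forall>a\<in>M. (\<lambda>E. c * a E) \<in> M) \<and>
    (\<forall>E. \<forall>a\<in>M. dual_act E a \<in> M)"


section \<open>Unbounded representations\<close>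

definition adjoint_domain :: "'h::complex_hilbert_space set \<Rightarrow> ('h \<Rightarrow> 'h) \<Rightarrow> 'h set" where
  "adjoint_domain F A = {\<eta>. \<exists>\<zeta>. \<forall>\<xi>\<in>F. cinner \<eta> (A \<xi>) = cinner \<zeta> \<xi>}"

text \<open>The value is uniquely determined on \<^const>\<open>adjoint_domain\<close> when \<open>F\<close> is dense.\<close>

definition adjoint_op :: "'h::complex_hilbert_space set \<Rightarrow> ('h \<Rightarrow> 'h) \<Rightarrow> 'h \<Rightarrow> 'h" where
  "adjoint_op F A \<eta> = (THE \<zeta>. \<forall>\<xi>\<in>F. cinner \<eta> (A \<xi>) = cinner \<zeta> \<xi>)"

text \<open>
  Operators with domain \<open>F\<close> are functions that are \<^const>\<open>undefined\<close> outside \<open>F\<close>, so that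
  equality of operators is equality of functions.
\<close>

definition op_algebra :: "'h::complex_hilbert_space set \<Rightarrow> ('h \<Rightarrow> 'h) set"  (\<open>\<L>\<^sup>\<dagger>\<close>) where
  "\<L>\<^sup>\<dagger> F = {A \<in> F \<rightarrow>\<^sub>E F.
    (\<forall>\<xi>\<in>F. \<forall>\<eta>\<in>F. A (\<xi> + \<eta>) = A \<xi> + A \<eta>) \<and> (\<forall>c. \<forall>\<xi>\<in>F. A (c *\<^sub>C \<xi>) = c *\<^sub>C A \<xi>) \<and>
    F \<subseteq> adjoint_domain F A \<and> adjoint_op F A ` F \<subseteq> F}"

definition op_dagger :: "'h::complex_hilbert_space set \<Rightarrow> ('h \<Rightarrow> 'h) \<Rightarrow> 'h \<Rightarrow> 'h" where
  "op_dagger F A = restrict (adjoint_op F A) F"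

definition unbounded_representation ::
  "'h::complex_hilbert_space set \<Rightarrow> ('g::lie_algebra uea \<Rightarrow> 'h \<Rightarrow> 'h) \<Rightarrow> bool" where
  "unbounded_representation F \<pi> \<longleftrightarrow>
    (\<forall>E. \<pi> E \<in> \<L>\<^sup>\<dagger> F) \<and>
    (\<forall>D E. \<pi> (D + E) = (\<lambda>\<xi>\<in>F. \<pi> D \<xi> + \<pi> E \<xi>)) \<and>
    (\<forall>c E. \<pi> (c *\<^sub>C E) = (\<lambda>\<xi>\<in>F. c *\<^sub>C \<pi> E \<xi>)) \<and>
    \<pi> 1 = (\<lambda>\<xi>\<in>F. \<xi>) \<and>
    (\<forall>D E. \<pi> (D * E) = compose F (\<pi> D) (\<pi> E)) \<and>
    (\<forall>E. \<pi> (uea_dagger E) = op_dagger F (\<pi> E))"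

definition anti_unitary :: "('h::complex_hilbert_space \<Rightarrow> 'h) \<Rightarrow> bool" where
  "anti_unitary J \<longleftrightarrow> antilinear J \<and> surj J \<and> (\<forall>\<xi> \<eta>. cinner (J \<xi>) (J \<eta>) = cinner \<eta> \<xi>)"

definition commutes_with_action ::
  "'h::complex_hilbert_space set \<Rightarrow> ('g::lie_algebra uea \<Rightarrow> 'h \<Rightarrow> 'h) \<Rightarrow> ('h \<Rightarrow> 'h) \<Rightarrow> bool" where
  "commutes_with_action F \<pi> J \<longleftrightarrow>
    J ` F \<subseteq> F \<and> (\<forall>x. \<forall>\<xi>\<in>F. J (\<pi> (uea_gen x) \<xi>) = \<pi> (uea_gen x) (J \<xi>))"

definition coefficient_functional ::
  "('g::lie_algebra uea \<Rightarrow> 'h::complex_hilbert_space \<Rightarrow> 'h) \<Rightarrow> ('h \<Rightarrow> 'h) \<Rightarrow> 'h \<Rightarrow> 'h \<Rightarrow> 'g uea \<Rightarrow> complex" where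
  "coefficient_functional \<pi> J \<nu> \<xi> E = cinner (J \<xi>) (\<pi> E \<nu>)"

end

theory Submission
  imports Defs
begin

text \<open>
  Since \<open>\<pi>\<close> respects the involutions and \<open>J \<pi>(E) = \<pi>(E') J\<close> on \<open>\<F>\<close>, where \<open>E'\<close> is the complex
  conjugate of \<open>E\<close>, moving \<open>E'\<^sup>\<dagger>\<close> across the scalar product gives
  \<open>\<langle>J\<xi>, E'\<^sup>\<dagger> F\<nu>\<rangle> = \<langle>E' J\<xi>, F\<nu>\<rangle> = \<langle>J E\<xi>, F\<nu>\<rangle>\<close>. Elements \<open>X\<close> of the Lie algebra are
  primitive for the coproduct and real, so they act on the dual as derivations that commute with the
  involution and annihilate the counit. Hence the elements of \<open>\<A>\<close> which every \<open>X\<close> maps into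
  \<open>\<A>\<close> form an involutive subalgebra, which contains the generators \<open>e\<^sub>\<xi>\<close> by the first part.
\<close>

section \<open>Scalar products and adjoints over a dense set\<close>

lemma cinner_add_left: "cinner (x + y) z = cinner x z + cinner y z"
  by (metis cinner_add_right cinner_commute complex_cnj_add)

lemma cinner_diff_left: "cinner (x - y) z = cinner x z - cinner y z"
  using cinner_add_left[of "x - y" y z] by simp

lemma cinner_diff_right: "cinner x (y - z) = cinner x y - cinner x z"
  using cinner_add_right[of x "y - z" z] by simp

text \<open>The difference of the two vectors is orthogonal to \<open>F\<close>, so its norm is at
  most its distance to any point of \<open>F\<close>, which density makes arbitrarily small. This
  yields uniqueness for the \<open>THE\<close> in \<open>adjoint_op\<close>.\<close>

lemma cinner_eq_on_dense:
  fixes F :: "'h::complex_hilbert_space set"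
  assumes dense: "closure F = UNIV" and eq: "\<And>\<xi>. \<xi> \<in> F \<Longrightarrow> cinner \<zeta> \<xi> = cinner \<zeta>' \<xi>"
  shows "\<zeta> = \<zeta>'"
proof -
  define \<delta> where "\<delta> = \<zeta> - \<zeta>'"
  have orth: "cinner \<delta> \<xi> = 0" if "\<xi> \<in> F" for \<xi>
    using eq[OF that] by (simp add: \<delta>_def cinner_diff_left)
  \<comment> \<open>Pythagoras replaces continuity of the scalar product.\<close>
  have le: "norm \<delta> \<le> norm (\<delta> - \<xi>)" if "\<xi> \<in> F" for \<xi>
  proof -
    have "cinner \<xi> \<delta> = 0" using orth[OF that] cinner_commute[of \<xi> \<delta>] by simp
    then have "cinner (\<delta> - \<xi>) (\<delta> - \<xi>) = cinner \<delta> \<delta> + cinner \<xi> \<xi>"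
      by (simp add: cinner_diff_left cinner_diff_right orth[OF that])
    then have "complex_of_real ((norm (\<delta> - \<xi>))\<^sup>2) = complex_of_real ((norm \<delta>)\<^sup>2 + (norm \<xi>)\<^sup>2)"
      by (simp add: cinner_self)
    then have "(norm \<delta>)\<^sup>2 \<le> (norm (\<delta> - \<xi>))\<^sup>2"
      unfolding of_real_eq_iff by simp
    then show ?thesis by (rule power2_le_imp_le) simp
  qed
  have "norm \<delta> < e" if "e > 0" for e
  proof -
    have "\<delta> \<in> closure F" by (simp add: dense)
    then obtain \<xi> where "\<xi> \<in> F" "dist \<xi> \<delta> < e"
      using \<open>e > 0\<close> unfolding closure_approachable by blast
    then show ?thesis using le[of \<xi>] by (simp add: dist_norm norm_minus_commute)
  qed
  then have "norm \<delta> = 0" by (metis less_irrefl norm_ge_zero order_le_less)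
  then show ?thesis by (simp add: \<delta>_def)
qed

lemma adjoint_op_cinner:
  assumes dense: "closure F = UNIV" and \<eta>: "\<eta> \<in> adjoint_domain F A" and \<xi>: "\<xi> \<in> F"
  shows "cinner \<eta> (A \<xi>) = cinner (adjoint_op F A \<eta>) \<xi>"
proof -
  obtain \<zeta> where \<zeta>: "\<forall>\<xi>\<in>F. cinner \<eta> (A \<xi>) = cinner \<zeta> \<xi>"
    using \<eta> by (auto simp: adjoint_domain_def)
  have "\<forall>\<xi>\<in>F. cinner \<eta> (A \<xi>) = cinner (adjoint_op F A \<eta>) \<xi>"
    unfolding adjoint_op_def
  proof (rule theI, rule \<zeta>)
    fix \<zeta>' assume "\<forall>\<xi>\<in>F. cinner \<eta> (A \<xi>) = cinner \<zeta>' \<xi>"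
    then show "\<zeta>' = \<zeta>" using \<zeta> by (intro cinner_eq_on_dense[OF dense]) simp
  qed
  then show ?thesis using \<xi> by simp
qed

section \<open>Unbounded representations and their coefficient functionals\<close>

lemma unbounded_representation_closed:
  "unbounded_representation F \<pi> \<Longrightarrow> \<xi> \<in> F \<Longrightarrow> \<pi> E \<xi> \<in> F"
  by (auto simp: unbounded_representation_def op_algebra_def)

lemma unbounded_representation_mult:
  "unbounded_representation F \<pi> \<Longrightarrow> \<xi> \<in> F \<Longrightarrow> \<pi> (D * E) \<xi> = \<pi> D (\<pi> E \<xi>)"
  by (simp add: unbounded_representation_def compose_def)

lemma unbounded_representation_linear:
  assumes "unbounded_representation F \<pi>" "\<xi> \<in> F"
  shows "\<pi> (D + E) \<xi> = \<pi> D \<xi> + \<pi> E \<xi>" "\<pi> (c *\<^sub>C E) \<xi> = c *\<^sub>C \<pi> E \<xi>" "\<pi> 1 \<xi> = \<xi>"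
  using assms by (simp_all add: unbounded_representation_def)

text \<open>By compatibility with the involutions, the adjoint of \<open>\<pi> E\<close> acts on
  \<open>F\<close> as \<open>\<pi> (uea_dagger E)\<close>.\<close>

lemma cinner_representation_dagger:
  assumes dense: "closure F = UNIV" and rep: "unbounded_representation F \<pi>"
    and F: "\<xi> \<in> F" "\<eta> \<in> F"
  shows "cinner \<xi> (\<pi> (uea_dagger E) \<eta>) = cinner (\<pi> E \<xi>) \<eta>"
proof -
  have "\<eta> \<in> adjoint_domain F (\<pi> E)"
    using rep F by (auto simp: unbounded_representation_def op_algebra_def)
  then have "cinner \<eta> (\<pi> E \<xi>) = cinner (adjoint_op F (\<pi> E) \<eta>) \<xi>"
    using adjoint_op_cinner dense F by blast
  also have "adjoint_op F (\<pi> E) \<eta> = \<pi> (uea_dagger E) \<eta>"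
    using rep F by (simp add: unbounded_representation_def op_dagger_def)
  \<comment> \<open>The adjoint relation has \<open>\<eta>\<close> in the first slot; conjugating
    both sides swaps the slots.\<close>
  finally show ?thesis by (metis cinner_commute)
qed

text \<open>The conjugation is multiplicative and fixes the generators, and it conjugates scalars
  just as \<open>J\<close> does, so commutation with the generators propagates to all of the
  enveloping algebra.\<close>

lemma antilinear_commutes_with_representation:
  assumes rep: "unbounded_representation F \<pi>" and J: "antilinear J" "commutes_with_action F \<pi> J"
    and \<xi>: "\<xi> \<in> F"
  shows "J (\<pi> E \<xi>) = \<pi> (uea_conj E) (J \<xi>)"
proof -
  have J\<xi>: "J \<xi> \<in> F" using J \<xi> by (auto simp: commutes_with_action_def)
  note lin = unbounded_representation_linear[OF rep]
  show ?thesis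
  proof (induction E rule: uea_induct)
    case 1
    show ?case using lin \<xi> J\<xi> by (simp add: uea_conj_1)
  next
    case (2 D E)
    then show ?case using lin \<xi> J\<xi>
      by (simp add: antilinear_add[OF J(1)] antilinear_add[OF uea_conj_antilinear])
  next
    case (3 c E)
    then show ?case using lin \<xi> J\<xi>
      by (simp add: antilinear_scale[OF J(1)] antilinear_scale[OF uea_conj_antilinear])
  next
    case (4 x E)
    then show ?case
      using J(2) \<xi> J\<xi> unbounded_representation_closed[OF rep \<xi>]
      by (simp add: unbounded_representation_mult[OF rep] uea_conj_mult uea_conj_gen
          commutes_with_action_def)
  qed
qed

lemma dual_act_coefficient_functional:
  assumes dense: "closure F = UNIV" and rep: "unbounded_representation F \<pi>" and \<nu>: "\<nu> \<in> F"
    and J: "antilinear J" "commutes_with_action F \<pi> J" and \<xi>: "\<xi> \<in> F"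
  shows "dual_act E (coefficient_functional \<pi> J \<nu> \<xi>) = coefficient_functional \<pi> J \<nu> (\<pi> E \<xi>)"
proof
  fix D
  have "J \<xi> \<in> F" using J \<xi> by (auto simp: commutes_with_action_def)
  \<comment> \<open>The dagger relation is used for \<open>uea_conj E\<close>, with
    \<open>J \<xi>\<close> and \<open>\<pi> D \<nu>\<close> as the two vectors of
    \<open>F\<close>.\<close>
  then show "dual_act E (coefficient_functional \<pi> J \<nu> \<xi>) D = coefficient_functional \<pi> J \<nu> (\<pi> E \<xi>) D"
    using cinner_representation_dagger[OF dense rep _ unbounded_representation_closed[OF rep \<nu>]]
    by (simp add: dual_act_def coefficient_functional_def unbounded_representation_mult[OF rep \<nu>]
        antilinear_commutes_with_representation[OF rep J \<xi>])
qed

lemma coefficient_functional_in_dual: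
  assumes "unbounded_representation F \<pi>" "\<nu> \<in> F"
  shows "coefficient_functional \<pi> J \<nu> \<xi> \<in> uea_dual"
  using unbounded_representation_linear[OF assms]
  by (simp add: uea_dual_def clinear_iff coefficient_functional_def cinner_add_right
      cinner_scaleC_right)

section \<open>Involution, unit and subalgebras of the dual\<close>

lemma dual_dagger_conj:
  assumes a: "a \<in> uea_dual"
  shows "dual_dagger a E = cnj (a (uea_conj E))"
proof -
  have a: "clinear a" using a by (simp add: uea_dual_def)
  \<comment> \<open>Both parts are real, so conjugation only changes the sign of
    \<open>\<i>\<close>.\<close>
  have "uea_conj E = uea_Re E - \<i> *\<^sub>C uea_Im E"
    using uea_Re_Im[of E] antilinear_add[OF uea_conj_antilinear, of "uea_Re E" "\<i> *\<^sub>C uea_Im E"]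
    by (simp add: uea_real_def antilinear_scale[OF uea_conj_antilinear])
  then show ?thesis
    by (simp add: dual_dagger_def clinear_diff[OF a] clinear_scale[OF a])
qed

lemma dual_dagger_closed:
  assumes a: "a \<in> uea_dual" shows "dual_dagger a \<in> uea_dual"
proof -
  have c: "clinear a" using a by (simp add: uea_dual_def)
  show ?thesis
    by (simp add: uea_dual_def clinear_iff dual_dagger_conj[OF a] antilinear_add[OF uea_conj_antilinear]
        antilinear_scale[OF uea_conj_antilinear] clinear_add[OF c] clinear_scale[OF c])
qed

lemma counit_in_dual: "counit \<in> uea_dual"
  unfolding uea_dual_def mem_Collect_eq
  by (rule counit_hom[unfolded unital_algebra_hom_def, THEN conjunct1])

lemma dual_unital_subalgebra_uea_dual: "dual_unital_subalgebra uea_dual"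
  using dual_mult_closed counit_in_dual
  by (auto simp: dual_unital_subalgebra_def uea_dual_def clinear_iff algebra_simps)

text \<open>Since \<open>uea_dual\<close> is itself closed under all operations and contains
  \<open>S\<close>, the intersection defining the hull stays inside \<open>uea_dual\<close>; the
  closure conditions pass to intersections.\<close>

lemma generated_involutive_subalgebra:
  assumes "S \<subseteq> uea_dual"
  shows "dual_unital_subalgebra (generated_involutive_subalgebra S)"
    and "\<And>a. a \<in> generated_involutive_subalgebra S \<Longrightarrow> dual_dagger a \<in> generated_involutive_subalgebra S"
proof -
  have "generated_involutive_subalgebra S \<subseteq> uea_dual"
    unfolding generated_involutive_subalgebra_def
    by (rule hull_minimal) (use assms dual_unital_subalgebra_uea_dual dual_dagger_closed in auto)
  then show "dual_unital_subalgebra (generated_involutive_subalgebra S)"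
    and "\<And>a. a \<in> generated_involutive_subalgebra S \<Longrightarrow> dual_dagger a \<in> generated_involutive_subalgebra S"
    unfolding generated_involutive_subalgebra_def hull_def dual_unital_subalgebra_def
    by blast+
qed

section \<open>The action of the enveloping algebra on its dual\<close>

lemma dual_act_closed:
  assumes a: "a \<in> uea_dual" shows "dual_act E a \<in> uea_dual"
proof -
  have "clinear a" using a by (simp add: uea_dual_def)
  then show ?thesis
    by (simp add: uea_dual_def clinear_iff dual_act_def distrib_left scaleC_mult_right)
qed

lemma dual_act_1: "dual_act 1 a = a"
  by (simp add: dual_act_def fun_eq_iff uea_conj_1 uea_dagger_1)

text \<open>The dagger reverses products and precomposition reverses them again, which makes this a
  left action.\<close>

lemma dual_act_mult: "dual_act (D * E) a = dual_act D (dual_act E a)"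
  by (simp add: dual_act_def fun_eq_iff uea_conj_mult uea_dagger_mult mult.assoc)

text \<open>Conjugation and dagger are both antilinear, so their composite is linear.\<close>

lemma dual_act_linear:
  assumes "a \<in> uea_dual"
  shows "dual_act (D + E) a = (\<lambda>G. dual_act D a G + dual_act E a G)"
    and "dual_act (c *\<^sub>C E) a = (\<lambda>G. c * dual_act E a G)"
proof -
  have a: "clinear a" using assms by (simp add: uea_dual_def)
  note anti = antilinear_add[OF uea_conj_antilinear] antilinear_add[OF uea_dagger_antilinear]
    antilinear_scale[OF uea_conj_antilinear] antilinear_scale[OF uea_dagger_antilinear]
  show "dual_act (D + E) a = (\<lambda>G. dual_act D a G + dual_act E a G)"
    by (simp add: dual_act_def fun_eq_iff anti distrib_right clinear_add[OF a])
  show "dual_act (c *\<^sub>C E) a = (\<lambda>G. c * dual_act E a G)"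
    by (simp add: dual_act_def fun_eq_iff anti scaleC_mult_left clinear_scale[OF a])
qed

text \<open>The sign comes from the dagger; it stays inside the argument because \<open>a\<close> is
  an arbitrary function here.\<close>

lemma dual_act_gen: "dual_act (uea_gen x) a E = a (- (uea_gen x * E))"
  by (simp add: dual_act_def uea_conj_gen uea_dagger_gen)

lemma clinear_minus: "clinear f \<Longrightarrow> f (- x) = - f x"
  using clinear_diff[of f 0 x] by (simp add: clinear_0)

lemma dual_act_gen_counit: "dual_act (uea_gen x) counit = (\<lambda>E. 0)"
proof
  fix E :: "'a uea"
  have "clinear (counit :: 'a uea \<Rightarrow> _)" "counit (uea_gen x * E) = counit (uea_gen x) * counit E"
    using counit_hom by (auto simp: unital_algebra_hom_def)
  then show "dual_act (uea_gen x) counit E = 0"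
    by (simp add: dual_act_gen clinear_minus counit_gen)
qed

text \<open>Leibniz rule: the coproduct is multiplicative and \<open>uea_gen x\<close> is primitive,
  so left multiplication by it acts on one tensor factor at a time.\<close>

lemma dual_act_gen_dual_mult:
  fixes x :: "'g::lie_algebra"
  assumes "a \<in> uea_dual" "b \<in> uea_dual"
  shows "dual_act (uea_gen x) (dual_mult a b) =
    (\<lambda>E. dual_mult (dual_act (uea_gen x) a) b E + dual_mult a (dual_act (uea_gen x) b) E)"
proof
  fix E
  let ?x = "uea_gen x"
  have a: "clinear a" and b: "clinear b" and xa: "clinear (dual_act ?x a)" and xb: "clinear (dual_act ?x b)"
    using assms dual_act_closed[OF assms(1)] dual_act_closed[OF assms(2)] by (simp_all add: uea_dual_def)
  have c: "clinear (coproduct :: 'g uea \<Rightarrow> _)"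
    and cm: "coproduct (D * E) = coproduct D * coproduct E" for D E :: "'g uea"
    using coproduct_hom by (auto simp: unital_algebra_hom_def)
  have ft: "clinear (functional_tensor f g)" for f g :: "'g uea \<Rightarrow> complex"
    unfolding functional_tensor_def by (rule clinear_ctensor_lift)
  \<comment> \<open>With an arbitrary tensor \<open>t\<close> in place of
    \<open>coproduct E\<close>, linearity reduces the identity to pure tensors.\<close>
  have "- functional_tensor a b ((1 \<otimes>\<^sub>C ?x + ?x \<otimes>\<^sub>C 1) * t) =
      functional_tensor (dual_act ?x a) b t + functional_tensor a (dual_act ?x b) t" for t
  proof (induction t rule: ctensor_induct)
    case (add s t)
    then show ?case by (simp add: distrib_left clinear_add[OF ft])
  next
    case (pure y z)
    have "functional_tensor (dual_act ?x a) b (y \<otimes>\<^sub>C z) = - a (?x * y) * b z"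
      "functional_tensor a (dual_act ?x b) (y \<otimes>\<^sub>C z) = a y * - b (?x * z)"
      unfolding functional_tensor_pure[OF xa b] functional_tensor_pure[OF a xb] dual_act_gen
        clinear_minus[OF a] clinear_minus[OF b] by (rule refl)+
    then show ?case
      by (simp add: distrib_right tensor_pure_mult clinear_add[OF ft] functional_tensor_pure a b)
  qed
  then show "dual_act ?x (dual_mult a b) E =
      dual_mult (dual_act ?x a) b E + dual_mult a (dual_act ?x b) E"
    by (simp add: dual_act_gen dual_mult_def clinear_minus[OF c] clinear_minus[OF ft] cm coproduct_gen)
qed

text \<open>As \<open>uea_gen x\<close> is real, conjugation commutes with left multiplication by
  it.\<close>

lemma dual_act_gen_dual_dagger:
  assumes "a \<in> uea_dual"
  shows "dual_act (uea_gen x) (dual_dagger a) = dual_dagger (dual_act (uea_gen x) a)"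
proof -
  have "uea_conj (- E) = - uea_conj E" for E :: "'a uea"
    using antilinear_diff[OF uea_conj_antilinear, of 0 E] antilinear_0[OF uea_conj_antilinear] by simp
  then show ?thesis
    by (simp add: fun_eq_iff dual_act_gen dual_dagger_conj[OF assms]
        dual_dagger_conj[OF dual_act_closed[OF assms]] uea_conj_mult uea_conj_gen)
qed

section \<open>Submodules and the generated involutive subalgebra\<close>

lemma dual_submodule_if_gen:
  assumes M: "dual_unital_subalgebra M" and gen: "\<And>x a. a \<in> M \<Longrightarrow> dual_act (uea_gen x) a \<in> M"
  shows "dual_submodule M"
proof -
  have sub: "M \<subseteq> uea_dual" and add: "\<And>a b. a \<in> M \<Longrightarrow> b \<in> M \<Longrightarrow> (\<lambda>E. a E + b E) \<in> M"
    and scale: "\<And>c a. a \<in> M \<Longrightarrow> (\<lambda>E. c * a E) \<in> M" and unit: "counit \<in> M"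
    using M by (auto simp: dual_unital_subalgebra_def)
  \<comment> \<open>The elements \<open>E\<close> that map \<open>M\<close> into itself include 1
    and are closed under sums, scalars and left multiplication by generators.\<close>
  have "\<forall>a\<in>M. dual_act E a \<in> M" for E
  proof (induction E rule: uea_induct)
    case (2 D E)
    then show ?case using sub add by (auto simp: dual_act_linear)
  next
    case (3 c E)
    then show ?case using sub scale by (auto simp: dual_act_linear)
  qed (simp_all add: dual_act_1 dual_act_mult gen)
  moreover have "(\<lambda>E. 0) \<in> M" using scale[OF unit, of 0] by simp
  ultimately show ?thesis using sub add scale by (auto simp: dual_submodule_def)
qed

lemma generated_involutive_subalgebra_submodule:
  assumes S: "S \<subseteq> uea_dual"
    and gen: "\<And>x a. a \<in> S \<Longrightarrow> dual_act (uea_gen x) a \<in> generated_involutive_subalgebra S"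
  shows "dual_submodule (generated_involutive_subalgebra S)"
proof -
  define M where "M = generated_involutive_subalgebra S"
  \<comment> \<open>Only generators are tested, because the Leibniz rule is available for them;
    arbitrary \<open>E\<close> follow by \<open>dual_submodule_if_gen\<close>.\<close>
  define B where "B = {a \<in> M. \<forall>x. dual_act (uea_gen x) a \<in> M}"
  have M: "dual_unital_subalgebra M" and dagger: "\<And>a. a \<in> M \<Longrightarrow> dual_dagger a \<in> M"
    using generated_involutive_subalgebra[OF S] by (auto simp: M_def)
  have sub: "M \<subseteq> uea_dual" and add: "\<And>a b. a \<in> M \<Longrightarrow> b \<in> M \<Longrightarrow> (\<lambda>E. a E + b E) \<in> M"
    and scale: "\<And>c a. a \<in> M \<Longrightarrow> (\<lambda>E. c * a E) \<in> M" and unit: "counit \<in> M"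
    and mult: "\<And>a b. a \<in> M \<Longrightarrow> b \<in> M \<Longrightarrow> dual_mult a b \<in> M"
    using M by (auto simp: dual_unital_subalgebra_def)
  have "S \<subseteq> M" unfolding M_def generated_involutive_subalgebra_def by (rule hull_subset)
  then have "S \<subseteq> B" using gen by (auto simp: B_def M_def)
  moreover have "dual_unital_subalgebra B"
    unfolding dual_unital_subalgebra_def
  proof (intro conjI ballI allI)
    show "B \<subseteq> uea_dual" using sub by (auto simp: B_def)
    \<comment> \<open>The counit is sent to the zero functional, which lies in \<open>M\<close> as 0
      times the counit.\<close>
    show "counit \<in> B" using unit scale[OF unit, of 0] by (simp add: B_def dual_act_gen_counit)
    fix a b assume ab: "a \<in> B" "b \<in> B"
    have "dual_act E (\<lambda>E. a E + b E) = (\<lambda>F. dual_act E a F + dual_act E b F)" for E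
      by (simp add: dual_act_def fun_eq_iff)
    then show "(\<lambda>E. a E + b E) \<in> B" using ab add by (simp add: B_def)
    have "a \<in> uea_dual" "b \<in> uea_dual" using ab sub by (auto simp: B_def)
    \<comment> \<open>Both Leibniz terms are products of elements of \<open>M\<close>; hence it
      suffices that \<open>B\<close> asks for images in \<open>M\<close> rather than in
      \<open>B\<close>.\<close>
    then show "dual_mult a b \<in> B"
      using ab add mult by (simp add: B_def dual_act_gen_dual_mult)
  next
    fix c a assume a: "a \<in> B"
    have "dual_act E (\<lambda>E. c * a E) = (\<lambda>F. c * dual_act E a F)" for E
      by (simp add: dual_act_def fun_eq_iff)
    then show "(\<lambda>E. c * a E) \<in> B" using a scale by (simp add: B_def)
  qed
  moreover have "dual_dagger a \<in> B" if "a \<in> B" for a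
  proof -
    have "a \<in> uea_dual" using that sub by (auto simp: B_def)
    then show ?thesis using that dagger by (simp add: B_def dual_act_gen_dual_dagger)
  qed
  ultimately have "M \<subseteq> B"
    unfolding M_def generated_involutive_subalgebra_def by (intro hull_minimal) auto
  then have "dual_submodule M"
    by (intro dual_submodule_if_gen[OF M]) (auto simp: B_def)
  then show ?thesis by (simp add: M_def)
qed

theorem proposition2p7:
  fixes F :: "'h::complex_hilbert_space set"
    and \<pi> :: "'g::lie_algebra uea \<Rightarrow> 'h \<Rightarrow> 'h"
    and J :: "'h \<Rightarrow> 'h"
    and \<nu> :: 'h
  assumes finite_dim: "\<exists>B :: 'g set. finite B \<and> span B = UNIV"
    and subspace: "csubspace F"
    and dense: "closure F = UNIV"
    and rep: "unbounded_representation F \<pi>"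
    and cyclic: "\<nu> \<in> F" "F = range (\<lambda>E. \<pi> E \<nu>)"
    and J: "anti_unitary J" "commutes_with_action F \<pi> J" "J \<nu> = \<nu>"
  shows "(\<forall>\<xi>\<in>F. \<forall>E. dual_act E (coefficient_functional \<pi> J \<nu> \<xi>)
            = coefficient_functional \<pi> J \<nu> (\<pi> E \<xi>)) \<and>
         dual_submodule (generated_involutive_subalgebra (coefficient_functional \<pi> J \<nu> ` F))"
proof -
  let ?e = "coefficient_functional \<pi> J \<nu>"
  have "antilinear J" using J(1) by (simp add: anti_unitary_def)
  note act = dual_act_coefficient_functional[OF dense rep cyclic(1) this J(2)]
  have "dual_submodule (generated_involutive_subalgebra (?e ` F))"
  proof (rule generated_involutive_subalgebra_submodule)
    show "?e ` F \<subseteq> uea_dual"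
      using coefficient_functional_in_dual[OF rep cyclic(1)] by blast
    fix x and a assume "a \<in> ?e ` F"
    \<comment> \<open>Generators go to generators: the functional of \<open>\<xi>\<close> is sent to
      that of \<open>\<pi> (uea_gen x) \<xi>\<close>, again a vector of \<open>F\<close>.\<close>
    then have "dual_act (uea_gen x) a \<in> ?e ` F"
      using act unbounded_representation_closed[OF rep] by auto
    then show "dual_act (uea_gen x) a \<in> generated_involutive_subalgebra (?e ` F)"
      unfolding generated_involutive_subalgebra_def by (rule hull_inc)
  qed
  with act show ?thesis by blast
qed

end
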